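(* Let $V=\mathbb R^{p,q}$, $W$ a $C\ell^0(V)$-module, $\Pi:\mathrm{Sym}^2W\to V$ an $\mathfrak o(V)$-equivariant linear map, $p=p'+p''$ with $p'\equiv3\pmod4$, and define $b_{\Pi,(\tilde e_i)}(s,t)=\langle\tilde e_1,\Pi(\tilde e_2\cdots\tilde e_{p'}s\vee t)\rangle$ and $b=b_{\Pi,(e_i)}$. Then: (1) if $\tilde e_1\wedge\cdots\wedge\tilde e_{p'}=\pm e_1\wedge\cdots\wedge e_{p'}$ then $b_{\Pi,(\tilde e_i)}=\pm b$; (2) $b$ is skew-symmetric, $b(t,s)=-b(s,t)$; (3) $b$ is invariant under $K(p',p'')=\mathrm{Spin}(p')\cdot\mathrm{Spin}_0(p'',q)$; (4) under $\mathfrak o(V)=\wedge^2E\oplus\wedge^2E'\oplus E\wedge E'$, elements of $E\wedge E'$ act on $W$ by $b$-symmetric endomorphisms ($b(As,t)=b(s,At)$) and elements of $\wedge^2E\oplus\wedge^2E'$ act by $b$-skew-symmetric endomorphisms ($b(As,t)=-b(s,At)$).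
   Context: Let $V=\mathbb{R}^{p,q}$ be $\mathbb R^{p+q}$ with the scalar product $\langle x,y\rangle=\sum_{i=1}^{p}x^iy^i-\sum_{j=p+1}^{p+q}x^jy^j$ and its standard orthonormal basis. $C\ell(V)$ is generated by $V$ subject to $xy+yx=-2\langle x,y\rangle1$, with even part $C\ell^0(V)$; $\mathrm{Spin}$, $\mathrm{Spin}_0$ as usual. Identify $\mathfrak{o}(V)=\wedge^2V$ via $(x\wedge y)(z)=\langle y,z\rangle x-\langle x,z\rangle y$; $x\wedge y\mapsto-\frac14(xy-yx)$ identifies $\mathfrak o(V)$ with $\mathfrak{spin}(V)\subset C\ell^0(V)$, through which $\mathfrak o(V)$ acts on $W$. $\mathrm{Sym}^2W$ is the symmetric square, $s\vee t$ the symmetric product. $e_1,\dots,e_{p'}$ are the first $p'$ standard basis vectors, spanning $E=\mathbb R^{p',0}$; $E'=E^\perp\cong\mathbb R^{p'',q}$; $(\tilde e_i)$ denotes any orthonormal basis of $E$, and products $\tilde e_2\cdots\tilde e_{p'}s$ are Clifford actions on $W$. $K(p',p'')$ is the connected subgroup of $\mathrm{Spin}_0(p,q)$ generated by $\mathrm{Spin}(E)$ and $\mathrm{Spin}_0(E')$. *)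

theory Defs
  imports "HOL-Analysis.Analysis" "HOL-Combinatorics.Permutations"
begin

(* V = R^{p,q}: vectors are functions nat => real, index i (0-based)   *)
(* stands for the (i+1)-st standard coordinate; only i < p+q matters.  *)

definition eta :: "nat \<Rightarrow> nat \<Rightarrow> real" where
  "eta p i = (if i < p then 1 else -1)"

definition innerV :: "nat \<Rightarrow> nat \<Rightarrow> (nat \<Rightarrow> real) \<Rightarrow> (nat \<Rightarrow> real) \<Rightarrow> real" where
  "innerV p q x y = (\<Sum>i<p+q. eta p i * x i * y i)"

definition Vspace :: "nat \<Rightarrow> nat \<Rightarrow> (nat \<Rightarrow> real) set" where
  "Vspace p q = {v. \<forall>i\<ge>p+q. v i = 0}"

definition stdb :: "nat \<Rightarrow> nat \<Rightarrow> real" where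
  "stdb i = (\<lambda>j. if j = i then 1 else 0)"

definition Espace :: "nat \<Rightarrow> nat \<Rightarrow> nat \<Rightarrow> (nat \<Rightarrow> real) set" where
  "Espace p q p' = {v \<in> Vspace p q. \<forall>i\<ge>p'. v i = 0}"

definition Espace' :: "nat \<Rightarrow> nat \<Rightarrow> nat \<Rightarrow> (nat \<Rightarrow> real) set" where
  "Espace' p q p' = {v \<in> Vspace p q. \<forall>i<p'. v i = 0}"

(* Clifford algebra Cl(p,q), realised on the basis e_I, I \<subseteq> {0..<p+q} *)
(* (increasingly ordered products), relation xy+yx = -2<x,y>.         *)
(* Elements: functions nat set => real vanishing outside Pow{..<p+q}.   *)

type_synonym cl = "nat set \<Rightarrow> real"

definition csign :: "nat \<Rightarrow> nat set \<Rightarrow> nat set \<Rightarrow> real" where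
  "csign p I J = (-1) ^ card {(i,j). i \<in> I \<and> j \<in> J \<and> j < i} * (\<Prod>i\<in>I \<inter> J. - eta p i)"

definition clmul :: "nat \<Rightarrow> nat \<Rightarrow> cl \<Rightarrow> cl \<Rightarrow> cl" where
  "clmul p q x y = (\<lambda>K. \<Sum>I\<in>Pow {..<p+q}. \<Sum>J\<in>Pow {..<p+q}.
      if (I - J) \<union> (J - I) = K then csign p I J * x I * y J else 0)"

definition clone :: cl where
  "clone = (\<lambda>I. if I = {} then 1 else 0)"

definition cladd :: "cl \<Rightarrow> cl \<Rightarrow> cl" where
  "cladd x y = (\<lambda>I. x I + y I)"

definition clscale :: "real \<Rightarrow> cl \<Rightarrow> cl" where
  "clscale c x = (\<lambda>I. c * x I)"

definition clvec :: "nat \<Rightarrow> nat \<Rightarrow> (nat \<Rightarrow> real) \<Rightarrow> cl" where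
  "clvec p q v = (\<lambda>I. if \<exists>i<p+q. I = {i} then v (the_elem I) else 0)"

definition clprod :: "nat \<Rightarrow> nat \<Rightarrow> cl list \<Rightarrow> cl" where
  "clprod p q xs = foldr (clmul p q) xs clone"

definition cleven :: "nat \<Rightarrow> nat \<Rightarrow> cl set" where
  "cleven p q = {x. \<forall>I. x I \<noteq> 0 \<longrightarrow> I \<subseteq> {..<p+q} \<and> even (card I)}"

(* x \<and> y  \<mapsto>  -1/4 (xy - yx) \<in> spin(V) \<subseteq> Cl^0(V) *)
definition clbiv :: "nat \<Rightarrow> nat \<Rightarrow> (nat \<Rightarrow> real) \<Rightarrow> (nat \<Rightarrow> real) \<Rightarrow> cl" where
  "clbiv p q x y = (\<lambda>I. - (1/4) * (clmul p q (clvec p q x) (clvec p q y) I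
                                   - clmul p q (clvec p q y) (clvec p q x) I))"

definition wedge_act :: "nat \<Rightarrow> nat \<Rightarrow> (nat \<Rightarrow> real) \<Rightarrow> (nat \<Rightarrow> real) \<Rightarrow> (nat \<Rightarrow> real) \<Rightarrow> (nat \<Rightarrow> real)" where
  "wedge_act p q x y z = (\<lambda>i. innerV p q y z * x i - innerV p q x z * y i)"

definition spinset :: "nat \<Rightarrow> nat \<Rightarrow> (nat \<Rightarrow> real) set \<Rightarrow> cl set" where
  "spinset p q S = {clprod p q (map (clvec p q) vs) | vs.
      even (length vs) \<and> (\<forall>v\<in>set vs. v \<in> S \<and> (innerV p q v v = 1 \<or> innerV p q v v = -1))}"

(* Spin_0(S): identity component (topology of the finite-dim. vector space Cl(V)) *)
definition spin0set :: "nat \<Rightarrow> nat \<Rightarrow> (nat \<Rightarrow> real) set \<Rightarrow> cl set" where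
  "spin0set p q S = connected_component_set (spinset p q S) clone"

(* K(p',p''): subgroup generated by Spin(E) and Spin_0(E') (both closed under inverses) *)
inductive_set Kgrp :: "nat \<Rightarrow> nat \<Rightarrow> nat \<Rightarrow> cl set" for p q p' where
  K_one: "clone \<in> Kgrp p q p'"
| K_mul: "g \<in> spinset p q (Espace p q p') \<union> spin0set p q (Espace' p q p') \<Longrightarrow>
          h \<in> Kgrp p q p' \<Longrightarrow> clmul p q g h \<in> Kgrp p q p'"

definition cl0_module :: "nat \<Rightarrow> nat \<Rightarrow> (cl \<Rightarrow> 'w::real_vector \<Rightarrow> 'w) \<Rightarrow> bool" where
  "cl0_module p q act \<longleftrightarrow>
     (\<forall>x\<in>cleven p q. \<forall>w1 w2. act x (w1 + w2) = act x w1 + act x w2) \<and>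
     (\<forall>x\<in>cleven p q. \<forall>c w. act x (c *\<^sub>R w) = c *\<^sub>R act x w) \<and>
     (\<forall>x\<in>cleven p q. \<forall>y\<in>cleven p q. \<forall>w. act (cladd x y) w = act x w + act y w) \<and>
     (\<forall>x\<in>cleven p q. \<forall>c w. act (clscale c x) w = c *\<^sub>R act x w) \<and>
     (\<forall>w. act clone w = w) \<and>
     (\<forall>x\<in>cleven p q. \<forall>y\<in>cleven p q. \<forall>w. act (clmul p q x y) w = act x (act y w))"

(* Pi : Sym^2 W \<rightarrow> V linear  <->  symmetric bilinear P : W \<times> W \<rightarrow> V,  P s t = Pi(s \<or> t) *)
definition sym_bilinear_V :: "nat \<Rightarrow> nat \<Rightarrow> ('w::real_vector \<Rightarrow> 'w \<Rightarrow> (nat \<Rightarrow> real)) \<Rightarrow> bool" where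
  "sym_bilinear_V p q P \<longleftrightarrow>
     (\<forall>s t. P s t \<in> Vspace p q) \<and>
     (\<forall>s t. P s t = P t s) \<and>
     (\<forall>s1 s2 t i. P (s1 + s2) t i = P s1 t i + P s2 t i) \<and>
     (\<forall>c s t i. P (c *\<^sub>R s) t i = c * P s t i)"

(* o(V)-equivariance; a general A \<in> o(V) = \<wedge>^2 V is a finite sum \<Sum>_k x_k \<and> y_k *)
definition equivariant :: "nat \<Rightarrow> nat \<Rightarrow> (cl \<Rightarrow> 'w::real_vector \<Rightarrow> 'w)
    \<Rightarrow> ('w \<Rightarrow> 'w \<Rightarrow> (nat \<Rightarrow> real)) \<Rightarrow> bool" where
  "equivariant p q act P \<longleftrightarrow>
     (\<forall>(m::nat) xs ys s t. (\<forall>k<m. xs k \<in> Vspace p q \<and> ys k \<in> Vspace p q) \<longrightarrow>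
        (let a = (\<lambda>I. \<Sum>k<m. clbiv p q (xs k) (ys k) I) in
          (\<lambda>i. P (act a s) t i + P s (act a t) i) =
          (\<lambda>i. \<Sum>k<m. wedge_act p q (xs k) (ys k) (P s t) i)))"

definition bform :: "nat \<Rightarrow> nat \<Rightarrow> nat \<Rightarrow> (cl \<Rightarrow> 'w::real_vector \<Rightarrow> 'w)
    \<Rightarrow> ('w \<Rightarrow> 'w \<Rightarrow> (nat \<Rightarrow> real)) \<Rightarrow> (nat \<Rightarrow> nat \<Rightarrow> real) \<Rightarrow> 'w \<Rightarrow> 'w \<Rightarrow> real" where
  "bform p q p' act P et s t =
     innerV p q (et 0) (P (act (clprod p q (map (\<lambda>i. clvec p q (et i)) [1..<p'])) s) t)"

definition orthonormal_basis_E :: "nat \<Rightarrow> nat \<Rightarrow> nat \<Rightarrow> (nat \<Rightarrow> nat \<Rightarrow> real) \<Rightarrow> bool" where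
  "orthonormal_basis_E p q p' et \<longleftrightarrow>
     (\<forall>i<p'. et i \<in> Espace p q p') \<and>
     (\<forall>i<p'. \<forall>j<p'. innerV p q (et i) (et j) = (if i = j then 1 else 0))"

(* Leibniz determinant of a k\<times>k matrix;  et_1\<and>...\<and>et_{p'} = detn p' (et i j) e_1\<and>...\<and>e_{p'} *)
definition detn :: "nat \<Rightarrow> (nat \<Rightarrow> nat \<Rightarrow> real) \<Rightarrow> real" where
  "detn k M = (\<Sum>\<sigma>\<in>{\<sigma>. \<sigma> permutes {..<k}}. of_int (sign \<sigma>) * (\<Prod>i<k. M i (\<sigma> i)))"

end

theory Submission
  imports Defs
begin

text \<open>
  Let \<open>\<omega> = e\<^sub>1 \<cdots> e\<^sub>p\<^sub>'\<close>. Since \<open>p' \<equiv> 3 (mod 4)\<close>, it is odd, \<open>\<omega>\<^sup>2 = 1\<close>, it commutes with \<open>E\<close> and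
  anticommutes with \<open>E'\<close>. Although \<open>W\<close> is only a module over the even part, \<open>T v = v \<omega>\<close> acts on it
  for every vector \<open>v\<close>; on \<open>E\<close> these operators satisfy the Clifford relations, and they commute with
  \<open>T y\<close> for \<open>y \<in> E'\<close>. In these terms \<open>b(s,t) = - \<langle>e\<^sub>1, \<Pi>(T e\<^sub>1 s \<or> t)\<rangle>\<close>.
  Applying equivariance twice gives \<open>\<Pi>(x y s \<or> x y t) = N\<^sub>x N\<^sub>y \<Pi>(s \<or> t)\<close> with
  \<open>N\<^sub>x z = \<langle>x,x\<rangle> z - 2 \<langle>x,z\<rangle> x\<close>, hence a formula for \<open>\<langle>w, \<Pi>(T v s \<or> T v t)\<rangle>\<close> with \<open>v, w \<in> E\<close>.
  Combined with equivariance under rotations of \<open>E\<close> it yields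
  \<open>\<langle>v, \<Pi>(T v s \<or> t)\<rangle> = - \<langle>v,v\<rangle> b(s,t)\<close> for all \<open>v \<in> E\<close>, which is independence of the basis, and that
  every \<open>T v\<close>, for \<open>v\<close> in \<open>E\<close> or \<open>E'\<close>, is \<open>b\<close>-skew. The behaviour of \<open>\<wedge>\<^sup>2E\<close>, \<open>\<wedge>\<^sup>2E'\<close> and \<open>E \<and> E'\<close>
  follows because \<open>x y\<close> is \<open>T x T y\<close> up to sign.
\<close>

section \<open>The Clifford algebra\<close>

lemma prod_sym_diff:
  fixes f :: "'a \<Rightarrow> real"
  assumes "finite A" "finite B" "\<And>x. f x * f x = 1"
  shows "prod f (sym_diff A B) = prod f A * prod f B"
proof -
  have "prod f (A \<inter> B) * prod f (A \<inter> B) = 1"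
    using assms(3) by (simp flip: prod.distrib)
  moreover have "prod f A = prod f (A - B) * prod f (A \<inter> B)"
    using prod.Int_Diff[OF assms(1), of f B] by (simp add: mult.commute)
  moreover have "prod f B = prod f (B - A) * prod f (A \<inter> B)"
    using prod.Int_Diff[OF assms(2), of f A] by (simp add: mult.commute Int_commute)
  moreover have "prod f (sym_diff A B) = prod f (A - B) * prod f (B - A)"
    using assms by (intro prod.union_disjoint) auto
  ultimately show ?thesis
    by (metis (no_types, opaque_lifting) mult.assoc mult.commute mult.right_neutral)
qed

lemma even_card_sym_diff:
  assumes "finite A" "finite B"
  shows "even (card (sym_diff A B)) \<longleftrightarrow> (even (card A) \<longleftrightarrow> even (card B))"
proof -
  have "card A = card (A - B) + card (A \<inter> B)"
    using card_Int_Diff[OF assms(1), of B] by simp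
  moreover have "card B = card (B - A) + card (A \<inter> B)"
    using card_Int_Diff[OF assms(2), of A] by (simp add: Int_commute)
  moreover have "card (sym_diff A B) = card (A - B) + card (B - A)"
    using assms by (intro card_Un_disjoint) auto
  ultimately show ?thesis by presburger
qed

text \<open>The sign of a single pair. Writing the parity of an inversion count as a product over
  pairs makes it multiplicative under symmetric difference in either index set.\<close>

definition ordsign :: "nat \<Rightarrow> nat \<Rightarrow> real" where
  "ordsign i j = (if j < i then -1 else 1)"

lemma ordsign_sq [simp]: "ordsign i j * ordsign i j = 1"
  by (simp add: ordsign_def)

lemma csign_eq_prod:
  assumes "finite I" "finite J"
  shows "csign p I J = (\<Prod>i\<in>I. \<Prod>j\<in>J. ordsign i j) * (\<Prod>i\<in>I \<inter> J. - eta p i)"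
proof -
  have eq: "{(i,j). i \<in> I \<and> j \<in> J \<and> j < i} = (SIGMA i:I. {j\<in>J. j < i})" by auto
  have "(-1::real) ^ card {(i,j). i \<in> I \<and> j \<in> J \<and> j < i} = (-1) ^ (\<Sum>i\<in>I. card {j\<in>J. j < i})"
    unfolding eq using assms by (subst card_SigmaI) auto
  also have "\<dots> = (\<Prod>i\<in>I. (-1) ^ card {j\<in>J. j < i})"
    by (simp add: power_sum)
  also have "\<dots> = (\<Prod>i\<in>I. \<Prod>j\<in>J. ordsign i j)"
  proof (rule prod.cong[OF refl])
    fix i
    have "J \<inter> {j. j < i} = {j\<in>J. j < i}" by auto
    then show "(-1::real) ^ card {j\<in>J. j < i} = (\<Prod>j\<in>J. ordsign i j)"
      using assms by (simp add: ordsign_def prod.If_cases)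
  qed
  finally show ?thesis by (simp add: csign_def)
qed

text \<open>This 2-cocycle identity is associativity on the level of blades. The ordering signs are
  multiplicative in each argument, and the metric factors on both sides run over the indices that
  lie in at least two of the three sets.\<close>

lemma csign_cocycle:
  assumes "finite I" "finite J" "finite K"
  shows "csign p I J * csign p (sym_diff I J) K = csign p I (sym_diff J K) * csign p J K"
proof -
  let ?h = "\<lambda>i. - eta p i"
  have 1: "(\<Prod>i\<in>sym_diff I J. \<Prod>k\<in>K. ordsign i k)
      = (\<Prod>i\<in>I. \<Prod>k\<in>K. ordsign i k) * (\<Prod>i\<in>J. \<Prod>k\<in>K. ordsign i k)"
    using assms by (intro prod_sym_diff) (simp_all flip: prod.distrib)
  have 2: "(\<Prod>i\<in>I. \<Prod>k\<in>sym_diff J K. ordsign i k)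
      = (\<Prod>i\<in>I. \<Prod>k\<in>J. ordsign i k) * (\<Prod>i\<in>I. \<Prod>k\<in>K. ordsign i k)"
    using assms by (simp add: prod_sym_diff prod.distrib)
  have "prod ?h (I \<inter> J) * prod ?h (sym_diff I J \<inter> K) = prod ?h ((I \<inter> J) \<union> (sym_diff I J \<inter> K))"
    using assms by (intro prod.union_disjoint[symmetric]) auto
  also have "(I \<inter> J) \<union> (sym_diff I J \<inter> K) = (I \<inter> sym_diff J K) \<union> (J \<inter> K)" by auto
  also have "prod ?h \<dots> = prod ?h (I \<inter> sym_diff J K) * prod ?h (J \<inter> K)"
    using assms by (intro prod.union_disjoint) auto
  finally have 3: "prod ?h (I \<inter> J) * prod ?h (sym_diff I J \<inter> K)
      = prod ?h (I \<inter> sym_diff J K) * prod ?h (J \<inter> K)" .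
  show ?thesis
    using assms 3 by (simp add: csign_eq_prod 1 2)
qed

definition blade :: "nat set \<Rightarrow> cl" where
  "blade I = (\<lambda>J. if J = I then 1 else 0)"

lemma clone_eq_blade: "clone = blade {}"
  by (simp add: clone_def blade_def)

section \<open>The Clifford product, its relations and its grading\<close>

locale clifford =
  fixes p q :: nat
begin

abbreviation Nset :: "nat set" where "Nset \<equiv> {..<p+q}"
abbreviation mul :: "cl \<Rightarrow> cl \<Rightarrow> cl" (infixr "\<odot>" 70) where "x \<odot> y \<equiv> clmul p q x y"
abbreviation vec :: "(nat \<Rightarrow> real) \<Rightarrow> cl" where "vec \<equiv> clvec p q"
abbreviation ip :: "(nat \<Rightarrow> real) \<Rightarrow> (nat \<Rightarrow> real) \<Rightarrow> real" where "ip \<equiv> innerV p q"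
abbreviation V :: "(nat \<Rightarrow> real) set" where "V \<equiv> Vspace p q"

text \<open>The type \<open>cl\<close> admits arbitrary functions on sets; \<open>clone\<close> is a
  unit only for those supported on subsets of \<open>Nset\<close>.\<close>

definition Cl :: "cl set" where "Cl = {x. \<forall>I. x I \<noteq> 0 \<longrightarrow> I \<subseteq> Nset}"

text \<open>For given \<open>I\<close> and \<open>K\<close> only \<open>J = sym_diff I K\<close>
  contributes, so the double sum of the definition collapses to a single one.\<close>

lemma clmul_eq:
  "(x \<odot> y) K = (if K \<subseteq> Nset then \<Sum>I\<in>Pow Nset. csign p I (sym_diff I K) * x I * y (sym_diff I K) else 0)"
proof (cases "K \<subseteq> Nset")
  case True
  have "(\<Sum>J\<in>Pow Nset. if sym_diff I J = K then csign p I J * x I * y J else 0)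
      = csign p I (sym_diff I K) * x I * y (sym_diff I K)" if "I \<in> Pow Nset" for I
  proof -
    have "sym_diff I J = K \<longleftrightarrow> J = sym_diff I K" for J by auto
    then show ?thesis using that True by simp blast
  qed
  then show ?thesis using True by (simp add: clmul_def)
next
  case False
  then have "(if sym_diff I J = K then csign p I J * x I * y J else 0) = 0"
    if "I \<in> Pow Nset" "J \<in> Pow Nset" for I J using that by auto
  then show ?thesis using False by (simp add: clmul_def)
qed

lemma clmul_in_Cl [simp]: "x \<odot> y \<in> Cl"
  by (simp add: Cl_def clmul_eq)

lemma clmul_assoc: "(x \<odot> y) \<odot> z = x \<odot> y \<odot> z"
proof
  fix K
  show "((x \<odot> y) \<odot> z) K = (x \<odot> y \<odot> z) K"
  proof (cases "K \<subseteq> Nset")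
    case True
    let ?N = "Pow Nset"
    let ?f = "\<lambda>I J. csign p I (sym_diff I K) * x I * (csign p J (sym_diff J (sym_diff I K)) * y J * z (sym_diff J (sym_diff I K)))"
    have fin: "finite I" if "I \<in> ?N" for I using that finite_subset by blast
    have "((x \<odot> y) \<odot> z) K = (\<Sum>L\<in>?N. csign p L (sym_diff L K) * (\<Sum>I\<in>?N. csign p I (sym_diff I L) * x I * y (sym_diff I L)) * z (sym_diff L K))"
      using True by (simp add: clmul_eq[of "x \<odot> y"]) (simp add: clmul_eq[of x])
    also have "\<dots> = (\<Sum>L\<in>?N. \<Sum>I\<in>?N. csign p L (sym_diff L K) * (csign p I (sym_diff I L) * x I * y (sym_diff I L)) * z (sym_diff L K))"
      by (simp add: sum_distrib_left sum_distrib_right)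
    also have "\<dots> = (\<Sum>I\<in>?N. \<Sum>L\<in>?N. csign p L (sym_diff L K) * (csign p I (sym_diff I L) * x I * y (sym_diff I L)) * z (sym_diff L K))"
      by (rule sum.swap)
    also have "\<dots> = (\<Sum>I\<in>?N. \<Sum>J\<in>?N. ?f I J)"
    proof (rule sum.cong[OF refl])
      fix I assume I: "I \<in> ?N"
      show "(\<Sum>L\<in>?N. csign p L (sym_diff L K) * (csign p I (sym_diff I L) * x I * y (sym_diff I L)) * z (sym_diff L K)) = (\<Sum>J\<in>?N. ?f I J)"
      \<comment> \<open>The index \<open>L\<close> of the intermediate product is traded for the
        second factor's index \<open>J = sym_diff I L\<close>; \<open>csign_cocycle\<close> then
        matches the signs.\<close>
      proof (rule sum.reindex_bij_witness[of _ "sym_diff I" "sym_diff I"])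
        fix L assume L: "L \<in> ?N"
        have [simp]: "sym_diff I (sym_diff I L) = L" by auto
        show "sym_diff I (sym_diff I L) = L" by simp
        show "sym_diff I L \<in> ?N" using I L by auto
        have e: "sym_diff (sym_diff I L) (sym_diff I K) = sym_diff L K" by auto
        have e2: "sym_diff (sym_diff I L) (sym_diff L K) = sym_diff I K" by auto
        have "csign p I (sym_diff I L) * csign p L (sym_diff L K)
            = csign p I (sym_diff I K) * csign p (sym_diff I L) (sym_diff L K)"
          using csign_cocycle[of I "sym_diff I L" "sym_diff L K" p] fin I L True
          by (simp add: e2 finite_subset)
        then show "?f I (sym_diff I L) = csign p L (sym_diff L K) * (csign p I (sym_diff I L) * x I * y (sym_diff I L)) * z (sym_diff L K)"
          unfolding e by (simp add: algebra_simps)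
      next
        fix L assume L: "L \<in> ?N"
        show "sym_diff I (sym_diff I L) = L" by auto
        show "sym_diff I L \<in> ?N" using I L by auto
      qed
    qed
    also have "\<dots> = (\<Sum>I\<in>?N. csign p I (sym_diff I K) * x I * (\<Sum>J\<in>?N. csign p J (sym_diff J (sym_diff I K)) * y J * z (sym_diff J (sym_diff I K))))"
      by (simp add: sum_distrib_left)
    also have "\<dots> = (x \<odot> y \<odot> z) K"
    proof -
      have "sym_diff I K \<subseteq> Nset" if "I \<in> ?N" for I using that True by auto
      then show ?thesis using True by (simp add: clmul_eq[of x] clmul_eq[of y])
    qed
    finally show ?thesis .
  next
    case False
    then show ?thesis by (simp only: clmul_eq if_False)
  qed
qed

lemma clmul_cladd: "x \<odot> cladd y z = cladd (x \<odot> y) (x \<odot> z)"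
  "cladd x y \<odot> z = cladd (x \<odot> z) (y \<odot> z)"
  by (simp_all add: fun_eq_iff clmul_eq cladd_def distrib_left distrib_right sum.distrib)

lemma clmul_clscale [simp]: "x \<odot> clscale c y = clscale c (x \<odot> y)"
  "clscale c x \<odot> y = clscale c (x \<odot> y)"
  by (simp_all add: fun_eq_iff clmul_eq clscale_def sum_distrib_left mult.assoc mult.left_commute)

lemma clscale_clscale [simp]: "clscale c (clscale d x) = clscale (c * d) x"
  by (simp add: clscale_def fun_eq_iff)

lemma clscale_one [simp]: "clscale 1 x = x"
  by (simp add: clscale_def)

lemma blade_in_Cl [simp]: "I \<subseteq> Nset \<Longrightarrow> blade I \<in> Cl"
  by (auto simp: Cl_def blade_def)

lemma clvec_in_Cl [simp]: "vec v \<in> Cl"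
  by (auto simp: Cl_def clvec_def split: if_splits)

lemma clone_in_Cl [simp]: "clone \<in> Cl"
  by (auto simp: Cl_def clone_def)

lemma blade_clmul:
  assumes "I \<subseteq> Nset" "K \<subseteq> Nset"
  shows "(blade I \<odot> x) K = csign p I (sym_diff I K) * x (sym_diff I K)"
proof -
  have "(blade I \<odot> x) K = (\<Sum>J\<in>Pow Nset. if J = I then csign p J (sym_diff J K) * x (sym_diff J K) else 0)"
  proof -
    have "csign p J (sym_diff J K) * blade I J * x (sym_diff J K)
        = (if J = I then csign p J (sym_diff J K) * x (sym_diff J K) else 0)" for J
      by (simp add: blade_def)
    then show ?thesis using assms by (simp only: clmul_eq if_True)
  qed
  also have "\<dots> = csign p I (sym_diff I K) * x (sym_diff I K)"
    using assms by (subst sum.delta) auto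
  finally show ?thesis .
qed

lemma blade_clmul_blade:
  assumes "I \<subseteq> Nset" "J \<subseteq> Nset"
  shows "blade I \<odot> blade J = clscale (csign p I J) (blade (sym_diff I J))"
proof
  fix K
  have eq: "sym_diff I K = J \<longleftrightarrow> K = sym_diff I J" by auto
  show "(blade I \<odot> blade J) K = clscale (csign p I J) (blade (sym_diff I J)) K"
  proof (cases "K \<subseteq> Nset")
    case True
    have "sym_diff I (sym_diff I J) = J" by auto
    then show ?thesis
      using assms True by (cases "K = sym_diff I J") (simp_all add: blade_clmul, simp_all add: blade_def clscale_def eq)
  next
    case False
    then have "K \<noteq> sym_diff I J" using assms by blast
    then show ?thesis using False by (simp add: clmul_eq blade_def clscale_def)
  qed
qed

lemma clone_clmul [simp]: "x \<in> Cl \<Longrightarrow> clone \<odot> x = x"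
proof
  fix K assume x: "x \<in> Cl"
  show "(clone \<odot> x) K = x K"
  proof (cases "K \<subseteq> Nset")
    case True
    then show ?thesis by (simp add: clone_eq_blade blade_clmul csign_def)
  next
    case False
    then show ?thesis using x by (auto simp: Cl_def clmul_eq[of _ _ K])
  qed
qed

lemma clmul_clone [simp]:
  assumes "x \<in> Cl"
  shows "x \<odot> clone = x"
proof
  fix K
  show "(x \<odot> clone) K = x K"
  proof (cases "K \<subseteq> Nset")
    case True
    have "(x \<odot> clone) K = (\<Sum>I\<in>Pow Nset. if I = K then x I else 0)"
    proof -
      have "sym_diff I K = {} \<longleftrightarrow> I = K" for I by auto
      then have "csign p I (sym_diff I K) * x I * clone (sym_diff I K) = (if I = K then x I else 0)" for I
        by (auto simp: clone_def csign_def)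
      then show ?thesis using True by (simp add: clmul_eq)
    qed
    then show ?thesis using True by simp
  next
    case False
    then show ?thesis using assms by (auto simp: clmul_eq Cl_def)
  qed
qed

lemma clvec_expand: "vec v K = (\<Sum>i<p+q. v i * blade {i} K)"
proof (cases "\<exists>i<p+q. K = {i}")
  case True
  then obtain i where i: "i < p + q" "K = {i}" by blast
  have "(\<Sum>j<p+q. v j * blade {j} K) = (\<Sum>j<p+q. if j = i then v j else 0)"
    by (intro sum.cong) (auto simp: i blade_def)
  then show ?thesis using i by (simp add: clvec_def)
next
  case False
  then have "(\<Sum>j<p+q. v j * blade {j} K) = 0" by (intro sum.neutral) (auto simp: blade_def)
  then show ?thesis using False by (auto simp: clvec_def)
qed

lemma clvec_clmul_expand: "(vec v \<odot> x) K = (\<Sum>i<p+q. v i * (blade {i} \<odot> x) K)"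
proof -
  have "csign p I L * vec v I * x L = (\<Sum>i<p+q. v i * (csign p I L * blade {i} I * x L))" for I L
    by (simp add: clvec_expand sum_distrib_left sum_distrib_right mult.assoc mult.left_commute)
  then show ?thesis
    by (cases "K \<subseteq> Nset") (simp_all only: clmul_eq sum_distrib_left if_True if_False mult_zero_right sum.neutral_const sum.swap[of _ "Pow Nset" "{..<p+q}"])
qed

lemma clmul_clvec_expand: "(x \<odot> vec v) K = (\<Sum>i<p+q. v i * (x \<odot> blade {i}) K)"
proof -
  have "csign p I L * x I * vec v L = (\<Sum>i<p+q. v i * (csign p I L * x I * blade {i} L))" for I L
    by (simp add: clvec_expand sum_distrib_left sum_distrib_right mult.assoc mult.left_commute)
  then show ?thesis
    by (cases "K \<subseteq> Nset") (simp_all only: clmul_eq sum_distrib_left if_True if_False mult_zero_right sum.neutral_const sum.swap[of _ "Pow Nset" "{..<p+q}"])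
qed

lemma clvec_stdb: "i < p + q \<Longrightarrow> vec (stdb i) = blade {i}"
  by (auto simp: fun_eq_iff clvec_expand stdb_def blade_def if_distrib[of "\<lambda>x. x * _"] cong: if_cong)

lemma blade_anticomm:
  assumes "i < p + q" "j < p + q"
  shows "(blade {i} \<odot> blade {j}) K + (blade {j} \<odot> blade {i}) K = (if i = j then - 2 * eta p i * clone K else 0)"
proof (cases "i = j")
  case True
  then show ?thesis
    using assms by (simp add: blade_clmul_blade csign_eq_prod ordsign_def clone_eq_blade clscale_def)
next
  case False
  have "sym_diff {j} {i} = sym_diff {i} {j}" by blast
  then show ?thesis
    using assms False by (simp add: blade_clmul_blade csign_eq_prod ordsign_def clscale_def)
qed

lemma clvec_anticomm_pt: "(vec u \<odot> vec v) K + (vec v \<odot> vec u) K = - 2 * ip u v * clone K"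
proof -
  have "(vec u \<odot> vec v) K = (\<Sum>i<p+q. \<Sum>j<p+q. u i * v j * (blade {i} \<odot> blade {j}) K)" for u v
    by (simp only: clvec_clmul_expand[of u "vec v"] clmul_clvec_expand[of "blade _"] sum_distrib_left mult.assoc)
  note e = this
  have "(vec v \<odot> vec u) K = (\<Sum>i<p+q. \<Sum>j<p+q. u i * v j * (blade {j} \<odot> blade {i}) K)"
    unfolding e by (subst sum.swap) (simp add: mult.commute)
  then have "(vec u \<odot> vec v) K + (vec v \<odot> vec u) K
      = (\<Sum>i<p+q. \<Sum>j<p+q. u i * v j * ((blade {i} \<odot> blade {j}) K + (blade {j} \<odot> blade {i}) K))"
    by (simp add: e sum.distrib distrib_left)
  also have "\<dots> = (\<Sum>i<p+q. \<Sum>j<p+q. if i = j then - 2 * (eta p i * u i * v i) * clone K else 0)"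
    by (intro sum.cong refl) (subst blade_anticomm, auto)
  also have "\<dots> = - 2 * ip u v * clone K"
    by (simp add: innerV_def sum_distrib_left sum_distrib_right sum_negf algebra_simps)
  finally show ?thesis .
qed

lemma clvec_anticomm: "cladd (vec u \<odot> vec v) (vec v \<odot> vec u) = clscale (- 2 * ip u v) clone"
  using clvec_anticomm_pt by (simp add: cladd_def clscale_def fun_eq_iff)

lemma clvec_sq: "vec v \<odot> vec v = clscale (- ip v v) clone"
proof
  fix K show "(vec v \<odot> vec v) K = clscale (- ip v v) clone K"
    using clvec_anticomm_pt[of v v K] unfolding clscale_def by linarith
qed

lemma clvec_linear: "vec (\<lambda>i. u i + c * v i) = cladd (vec u) (clscale c (vec v))"
  by (auto simp: fun_eq_iff clvec_def cladd_def clscale_def)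

lemma cleven_clone [simp]: "clone \<in> cleven p q"
  by (auto simp: cleven_def clone_def)

lemma cleven_clscale [simp]: "x \<in> cleven p q \<Longrightarrow> clscale c x \<in> cleven p q"
  by (auto simp: cleven_def clscale_def)

lemma cleven_cladd [simp]: "x \<in> cleven p q \<Longrightarrow> y \<in> cleven p q \<Longrightarrow> cladd x y \<in> cleven p q"
  by (simp add: cleven_def cladd_def) (metis add.right_neutral)

text \<open>Arguments about the parity or the support of a product reduce to one pair of
  contributing blades.\<close>

lemma clmul_nonzero_obtain:
  assumes "(x \<odot> y) K \<noteq> 0"
  obtains I J where "I \<subseteq> Nset" "J \<subseteq> Nset" "K = sym_diff I J" "x I \<noteq> 0" "y J \<noteq> 0"
proof -
  have K: "K \<subseteq> Nset" using assms by (auto simp: clmul_eq split: if_splits)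
  then obtain I where I: "I \<subseteq> Nset" "csign p I (sym_diff I K) * x I * y (sym_diff I K) \<noteq> 0"
    using assms by (auto simp: clmul_eq elim!: sum.not_neutral_contains_not_neutral)
  show ?thesis
    by (rule that[of I "sym_diff I K"]) (use I K in auto)
qed

lemma cleven_clmul [simp]:
  assumes "x \<in> cleven p q" "y \<in> cleven p q"
  shows "x \<odot> y \<in> cleven p q"
proof -
  have "K \<subseteq> Nset \<and> even (card K)" if nz: "(x \<odot> y) K \<noteq> 0" for K
  proof -
    obtain I J where "I \<subseteq> Nset" "J \<subseteq> Nset" "K = sym_diff I J" "x I \<noteq> 0" "y J \<noteq> 0"
      using clmul_nonzero_obtain[OF nz] by blast
    moreover from this have "even (card I)" "even (card J)" "finite I" "finite J"
      using assms finite_subset[of _ Nset] by (auto simp: cleven_def)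
    ultimately show ?thesis by (auto simp: even_card_sym_diff)
  qed
  then show ?thesis by (simp add: cleven_def)
qed

definition clodd :: "cl set" where
  "clodd = {x. \<forall>I. x I \<noteq> 0 \<longrightarrow> I \<subseteq> Nset \<and> odd (card I)}"

lemma clodd_clmul_clodd [simp]:
  assumes "x \<in> clodd" "y \<in> clodd"
  shows "x \<odot> y \<in> cleven p q"
proof -
  have "K \<subseteq> Nset \<and> even (card K)" if nz: "(x \<odot> y) K \<noteq> 0" for K
  proof -
    obtain I J where "I \<subseteq> Nset" "J \<subseteq> Nset" "K = sym_diff I J" "x I \<noteq> 0" "y J \<noteq> 0"
      using clmul_nonzero_obtain[OF nz] by blast
    moreover from this have "odd (card I)" "odd (card J)" "finite I" "finite J"
      using assms finite_subset[of _ Nset] by (auto simp: clodd_def)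
    ultimately show ?thesis by (auto simp: even_card_sym_diff)
  qed
  then show ?thesis by (simp add: cleven_def)
qed

lemma clvec_clodd [simp]: "vec v \<in> clodd"
  by (auto simp: clodd_def clvec_def split: if_splits)

lemma blade_clodd: "I \<subseteq> Nset \<Longrightarrow> odd (card I) \<Longrightarrow> blade I \<in> clodd"
  by (simp add: clodd_def blade_def)

lemma blade_cleven: "I \<subseteq> Nset \<Longrightarrow> even (card I) \<Longrightarrow> blade I \<in> cleven p q"
  by (simp add: cleven_def blade_def)

lemma clprod_simps [simp]: "clprod p q [] = clone" "clprod p q (x # xs) = x \<odot> clprod p q xs"
  by (simp_all add: clprod_def)

lemma clprod_in_Cl [simp]: "clprod p q xs \<in> Cl"
  by (cases xs) auto

lemma clprod_append: "clprod p q (xs @ ys) = clprod p q xs \<odot> clprod p q ys"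
  by (induction xs) (simp_all add: clmul_assoc)

lemma clprod_even:
  assumes "even (length vs)"
  shows "clprod p q (map vec vs) \<in> cleven p q"
  using assms
proof (induction vs rule: induct_list012)
  case (3 u v vs)
  then show ?case by (simp flip: clmul_assoc)
qed auto

text \<open>Anticommutation eliminates the product in the order \<open>y\<close>, \<open>x\<close>,
  so a bivector acts through one product of two vectors and a scalar.\<close>

lemma clbiv_eq:
  "clbiv p q x y = cladd (clscale (- 1/2) (vec x \<odot> vec y)) (clscale (- ip x y / 2) clone)"
proof
  fix K
  have "(vec y \<odot> vec x) K = - (vec x \<odot> vec y) K - 2 * ip x y * clone K"
    using clvec_anticomm_pt[of x y K] by simp
  then show "clbiv p q x y K = cladd (clscale (- 1/2) (vec x \<odot> vec y)) (clscale (- ip x y / 2) clone) K"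
    by (simp add: clbiv_def cladd_def clscale_def field_simps)
qed

lemma clbiv_even [simp]: "clbiv p q x y \<in> cleven p q"
  by (simp add: clbiv_eq)

lemma spinset_even: "spinset p q S \<subseteq> cleven p q"
  by (auto simp: spinset_def intro: clprod_even)

end

section \<open>The volume element\<close>

lemma prod_ordsign_left: "(\<Prod>k<m. ordsign i k) = (-1) ^ min i m"
  by (induction m) (auto simp: ordsign_def min_def not_less_eq_eq le_Suc_eq)

text \<open>The exponent counts the \<open>k\<close> with \<open>i < k < m\<close>; truncated
  subtraction gives the correct count 0 when \<open>m\<close> does not exceed
  \<open>i\<close>.\<close>

lemma prod_ordsign_right: "(\<Prod>k<m. ordsign k i) = (-1) ^ (m - 1 - i)"
proof (induction m)
  case (Suc m)
  show ?case
  proof (cases "i < m")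
    case True
    then have "m - i = Suc (m - 1 - i)" by simp
    then show ?thesis using Suc True by (simp add: ordsign_def)
  next
    case False
    then show ?thesis using Suc by (simp add: ordsign_def)
  qed
qed simp

text \<open>This is the sign of the square of the volume element. Four consecutive factors multiply
  to 1, and the first three are -1, 1, -1; the residue 1 modulo 4 would give -1 instead.\<close>

lemma prod_alternating_sign: "(\<Prod>i<4*k+3. - ((-1::real) ^ i)) = 1"
proof (induction k)
  case 0
  then show ?case by (simp add: numeral_3_eq_3)
next
  case (Suc k)
  have "4 * Suc k + 3 = Suc (Suc (Suc (Suc (4*k+3))))" by simp
  then show ?case using Suc by (simp only: prod.lessThan_Suc) simp
qed

context clifford
begin

lemma innerV_commute: "ip u v = ip v u"
  by (simp add: innerV_def mult.commute mult.left_commute)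

lemma innerV_linear: "ip (\<lambda>i. u i + c * v i) w = ip u w + c * ip v w"
  "ip w (\<lambda>i. u i + c * v i) = ip w u + c * ip w v"
  by (simp_all add: innerV_def sum.distrib sum_distrib_left algebra_simps)

lemma innerV_stdb: "i < p + q \<Longrightarrow> ip u (stdb i) = eta p i * u i"
  by (simp add: innerV_def stdb_def if_distrib[of "\<lambda>x. _ * x"] cong: if_cong)

lemma innerV_stdb_left: "i < p + q \<Longrightarrow> ip (stdb i) u = eta p i * u i"
  by (simp add: innerV_commute innerV_stdb)

lemma clprod_stdb:
  assumes "k \<le> m" "m \<le> p + q"
  shows "clprod p q (map (\<lambda>i. vec (stdb i)) [k..<m]) = blade {k..<m}"
  using assms(1)
proof (induction k rule: inc_induct)
  case base
  then show ?case by (simp add: clone_eq_blade)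
next
  case (step k)
  have "sym_diff {k} {Suc k..<m} = {k..<m}" using step by auto
  moreover have "csign p {k} {Suc k..<m} = 1"
    by (simp add: csign_eq_prod ordsign_def)
  moreover have "{Suc k..<m} \<subseteq> Nset" using assms by auto
  ultimately show ?case
    using step assms by (simp add: upt_conv_Cons clvec_stdb blade_clmul_blade)
qed

end

section \<open>The splitting of V into E and its complement, and the volume element of E\<close>

locale clifford_split = clifford +
  fixes p' :: nat
  assumes p'_le: "p' \<le> p" and p'_mod: "p' mod 4 = 3"
begin

abbreviation E where "E \<equiv> Espace p q p'"
abbreviation E' where "E' \<equiv> Espace' p q p'"
abbreviation e where "e \<equiv> stdb 0"

definition omega :: cl where "omega = blade {..<p'}"

lemma p'_odd: "odd p'" and p'_ge: "3 \<le> p'"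
  using p'_mod by presburger+

lemma E_V: "v \<in> E \<Longrightarrow> v \<in> V" and E'_V: "v \<in> E' \<Longrightarrow> v \<in> V"
  by (simp_all add: Espace_def Espace'_def)

lemma stdb_E: "i < p' \<Longrightarrow> stdb i \<in> E"
  using p'_le by (auto simp: Espace_def Vspace_def stdb_def)

lemma E_linear: "u \<in> E \<Longrightarrow> v \<in> E \<Longrightarrow> (\<lambda>i. u i + c * v i) \<in> E"
  by (simp add: Espace_def Vspace_def)

lemma innerV_E_E': "u \<in> E \<Longrightarrow> y \<in> E' \<Longrightarrow> ip u y = 0"
  unfolding innerV_def by (intro sum.neutral) (auto simp: Espace_def Espace'_def, meson not_le)

lemma innerV_E: "u \<in> E \<Longrightarrow> ip u v = (\<Sum>i<p'. u i * v i)"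
proof -
  assume u: "u \<in> E"
  have "ip u v = (\<Sum>i<p'. eta p i * u i * v i)"
    unfolding innerV_def using u p'_le
    by (intro sum.mono_neutral_right) (auto simp: Espace_def)
  also have "\<dots> = (\<Sum>i<p'. u i * v i)"
    using p'_le by (intro sum.cong) (auto simp: eta_def)
  finally show ?thesis .
qed

text \<open>\<open>E\<close> lies in the positive part of V, so the form is definite there. This is
  what later allows cancelling \<open>ip v v\<close>.\<close>

lemma innerV_E_eq_0: "u \<in> E \<Longrightarrow> ip u u = 0 \<Longrightarrow> u = (\<lambda>_. 0)"
proof
  fix i assume u: "u \<in> E" "ip u u = 0"
  then have "\<forall>i\<in>{..<p'}. u i * u i = 0"
    by (simp add: innerV_E sum_nonneg_eq_0_iff)
  then show "u i = 0" using u by (cases "i < p'") (auto simp: Espace_def)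
qed

lemma innerV_e: "ip e v = v 0" "ip v e = v 0"
  using p'_le p'_ge by (simp_all add: innerV_stdb innerV_stdb_left eta_def)

lemma e_E: "e \<in> E" using p'_ge by (simp add: stdb_E)

lemma ip_e_e [simp]: "ip e e = 1"
  by (simp add: innerV_e) (simp add: stdb_def)

lemma subset_Nset: "{..<p'} \<subseteq> Nset" using p'_le by auto

lemma omega_clodd [simp]: "omega \<in> clodd"
  using p'_odd subset_Nset by (simp add: omega_def blade_clodd)

lemma omega_in_Cl [simp]: "omega \<in> Cl"
  using subset_Nset by (simp add: omega_def)

lemma csign_omega:
  "csign p {..<p'} {i} = (-1) ^ (p' - 1 - i) * (if i < p' then - eta p i else 1)"
  "csign p {i} {..<p'} = (-1) ^ (min i p') * (if i < p' then - eta p i else 1)"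
  by (simp_all add: csign_eq_prod prod_ordsign_right prod_ordsign_left)

text \<open>Compare inversion counts: for \<open>i < p'\<close> they are \<open>p' - 1 - i\<close>
  and \<open>i\<close>, of equal parity because \<open>p'\<close> is odd; for larger
  \<open>i\<close> they are 0 and \<open>p'\<close>, of opposite parity.\<close>

lemma omega_blade:
  assumes "i < p + q"
  shows "omega \<odot> blade {i} = clscale (if i < p' then 1 else - 1) (blade {i} \<odot> omega)"
proof -
  have eq: "sym_diff {i} {..<p'} = sym_diff {..<p'} {i}" by auto
  have "even (p' - 1 - i) \<longleftrightarrow> even i" if "i < p'" using p'_odd that by auto
  then have "csign p {..<p'} {i} = (if i < p' then 1 else - 1) * csign p {i} {..<p'}"
    using p'_odd by (auto simp: csign_omega min_def minus_one_power_iff)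
  then show ?thesis
    using assms subset_Nset by (simp add: omega_def blade_clmul_blade eq)
qed

lemma omega_E: "v \<in> E \<Longrightarrow> omega \<odot> vec v = vec v \<odot> omega"
proof
  fix K assume v: "v \<in> E"
  show "(omega \<odot> vec v) K = (vec v \<odot> omega) K"
    unfolding clvec_clmul_expand clmul_clvec_expand
    using v by (intro sum.cong refl) (auto simp: omega_blade Espace_def)
qed

lemma omega_E': "v \<in> E' \<Longrightarrow> omega \<odot> vec v = clscale (- 1) (vec v \<odot> omega)"
proof
  fix K assume v: "v \<in> E'"
  have "(omega \<odot> vec v) K = (\<Sum>i<p+q. - 1 * (v i * (blade {i} \<odot> omega) K))"
    unfolding clmul_clvec_expand
    using v by (intro sum.cong refl) (auto simp: omega_blade Espace'_def clscale_def)
  then show "(omega \<odot> vec v) K = clscale (- 1) (vec v \<odot> omega) K"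
    by (simp add: clvec_clmul_expand clscale_def sum_negf)
qed

lemma omega_sq: "omega \<odot> omega = clone"
proof -
  obtain k where k: "p' = 4 * k + 3"
    using p'_mod by (metis mult.commute div_mult_mod_eq)
  \<comment> \<open>The index \<open>i\<close> contributes \<open>(-1) ^ i\<close> from reordering
    and -1 from the square of its basis vector.\<close>
  have "csign p {..<p'} {..<p'} = (\<Prod>i<p'. (-1) ^ i * (- eta p i))"
    by (auto simp: csign_eq_prod prod_ordsign_left min_def simp flip: prod.distrib intro!: prod.cong)
  also have "\<dots> = (\<Prod>i<p'. - ((-1) ^ i))"
    using p'_le by (intro prod.cong) (auto simp: eta_def)
  also have "\<dots> = 1" unfolding k by (rule prod_alternating_sign)
  finally show ?thesis
    using subset_Nset by (simp add: omega_def blade_clmul_blade clone_eq_blade)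
qed

text \<open>A unit vector of norm 1 squares to -1, so the truncated product in \<open>bform\<close>
  is recovered from the full one, which for suitable bases is a multiple of
  \<open>omega\<close>.\<close>

lemma clprod_tail:
  assumes "ip (u 0) (u 0) = 1"
  shows "clprod p q (map (\<lambda>i. vec (u i)) [1..<p'])
    = clscale (- 1) (vec (u 0) \<odot> clprod p q (map (\<lambda>i. vec (u i)) [0..<p']))"
proof -
  have "[0..<p'] = 0 # [1..<p']" using p'_ge by (simp add: upt_conv_Cons)
  then show ?thesis using assms by (simp add: clvec_sq flip: clmul_assoc)
qed

lemma clprod_stdb_tail:
  "clprod p q (map (\<lambda>i. vec (stdb i)) [1..<p']) = clscale (- 1) (vec e \<odot> omega)"
proof -
  have "clprod p q (map (\<lambda>i. vec (stdb i)) [0..<p']) = omega"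
    using p'_le by (simp add: clprod_stdb omega_def atLeast0LessThan)
  then show ?thesis using clprod_tail[of stdb] by simp
qed

end

section \<open>Determinants as top coefficients of Clifford products\<close>

context clifford
begin

lemma blade_anticomm_neq:
  assumes "i < p + q" "j < p + q" "i \<noteq> j"
  shows "blade {i} \<odot> blade {j} = clscale (- 1) (blade {j} \<odot> blade {i})"
proof
  fix K show "(blade {i} \<odot> blade {j}) K = clscale (- 1) (blade {j} \<odot> blade {i}) K"
    using blade_anticomm[OF assms(1,2), of K] assms(3) by (simp add: clscale_def)
qed

abbreviation bprod :: "nat list \<Rightarrow> cl" where
  "bprod js \<equiv> clprod p q (map (\<lambda>j. blade {j}) js)"

lemma blade_bprod_commute:
  assumes "i < p + q" "set js \<subseteq> Nset" "i \<notin> set js"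
  shows "blade {i} \<odot> bprod js = clscale ((-1) ^ length js) (bprod js \<odot> blade {i})"
  using assms(2,3)
proof (induction js)
  case Nil
  then show ?case using assms(1) by simp
next
  case (Cons j js)
  have "blade {i} \<odot> blade {j} \<odot> bprod js = clscale (- 1) (blade {j} \<odot> blade {i} \<odot> bprod js)"
    using blade_anticomm_neq[of i j] assms(1) Cons.prems by (simp flip: clmul_assoc)
  then show ?case using Cons by (simp add: clmul_assoc)
qed

text \<open>Either vector picks up the same sign \<open>(-1) ^ length ys\<close> when it passes the
  block between them, so the two orders differ only by the exchange of two adjacent anticommuting
  vectors.\<close>

lemma bprod_swap:
  assumes "distinct (xs @ i # ys @ j # zs)" "set (xs @ i # ys @ j # zs) \<subseteq> Nset"
  shows "bprod (xs @ j # ys @ i # zs) = clscale (- 1) (bprod (xs @ i # ys @ j # zs))"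
proof -
  have ij: "i < p + q" "j < p + q" "i \<noteq> j" "i \<notin> set ys" "j \<notin> set ys" "set ys \<subseteq> Nset"
    using assms by auto
  let ?c = "(-1::real) ^ length ys"
  have move: "blade {k} \<odot> bprod ys \<odot> z = clscale ?c (bprod ys \<odot> blade {k} \<odot> z)"
    if "k < p + q" "k \<notin> set ys" for k z
    using blade_bprod_commute[OF that(1) ij(6) that(2)] clmul_assoc[of "blade {k}" "bprod ys" z]
    by (simp add: clmul_assoc)
  have "blade {j} \<odot> blade {i} \<odot> bprod zs = clscale (- 1) (blade {i} \<odot> blade {j} \<odot> bprod zs)"
    using blade_anticomm_neq[of j i] ij by (simp flip: clmul_assoc)
  then have "blade {j} \<odot> bprod ys \<odot> blade {i} \<odot> bprod zs = clscale (- 1) (blade {i} \<odot> bprod ys \<odot> blade {j} \<odot> bprod zs)"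
    using ij by (simp add: move)
  then show ?thesis by (simp add: clprod_append)
qed

lemma bprod_transpose:
  assumes "distinct js" "set js \<subseteq> Nset" "a \<in> set js" "b \<in> set js" "a \<noteq> b"
  shows "bprod (map (Transposition.transpose a b) js) = clscale (- 1) (bprod js)"
proof -
  have *: "bprod (map (Transposition.transpose i j) js) = clscale (- 1) (bprod js)"
    if js: "js = xs @ i # ys @ j # zs" for i j xs ys zs
  proof -
    have "map (Transposition.transpose i j) us = us" if "i \<notin> set us" "j \<notin> set us" for us
      using that by (intro map_idI) (metis transpose_apply_other)
    then have "map (Transposition.transpose i j) js = xs @ j # ys @ i # zs"
      using assms(1) js by auto
    then show ?thesis using assms(1,2) bprod_swap[of xs i ys j zs] js by simp
  qed
  obtain xs ys where js: "js = xs @ a # ys" using split_list[OF assms(3)] by blast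
  then consider "b \<in> set xs" | "b \<in> set ys" using assms(4,5) by auto
  then show ?thesis
  proof cases
    case 1
    then obtain us vs where "xs = us @ b # vs" using split_list[of b] by blast
    then show ?thesis using *[of us b vs a ys] js by (simp add: transpose_commute)
  next
    case 2
    then obtain us vs where "ys = us @ b # vs" using split_list[of b] by blast
    then show ?thesis using *[of xs a us b vs] js by simp
  qed
qed

lemma bprod_permutes:
  assumes "\<sigma> permutes {..<k}" "k \<le> p + q"
  shows "bprod (map \<sigma> [0..<k]) = clscale (of_int (sign \<sigma>)) (blade {..<k})"
  using assms(1) finite_lessThan
proof (induction rule: permutes_induct)
  case id
  have "bprod [0..<k] = clprod p q (map (\<lambda>i. vec (stdb i)) [0..<k])"
    using assms(2) by (intro arg_cong[of _ _ "clprod p q"] map_cong) (auto simp: clvec_stdb)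
  then show ?case using clprod_stdb[of 0 k] assms(2) by (simp add: atLeast0LessThan)
next
  case (swap a b \<sigma>)
  have perm: "\<sigma> permutes {..<k}" by fact
  have set: "set (map \<sigma> [0..<k]) = {..<k}"
    using permutes_image[OF perm] by (simp add: atLeast0LessThan)
  have "bprod (map (Transposition.transpose a b) (map \<sigma> [0..<k])) = clscale (- 1) (bprod (map \<sigma> [0..<k]))"
  proof (rule bprod_transpose)
    show "distinct (map \<sigma> [0..<k])"
      using permutes_inj_on[OF perm] by (simp add: distinct_map)
    show "set (map \<sigma> [0..<k]) \<subseteq> Nset" "a \<in> set (map \<sigma> [0..<k])" "b \<in> set (map \<sigma> [0..<k])"
      unfolding set using swap assms by auto
  qed (use swap in simp)
  moreover have "sign (Transposition.transpose a b \<circ> \<sigma>) = - sign \<sigma>"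
    using swap permutation_permutes[of \<sigma>] by (subst sign_compose) (auto simp: permutation_swap_id sign_swap_id)
  ultimately show ?case
    using swap by (simp add: comp_def)
qed

text \<open>For the top coefficient this discards every list of indices that does not cover all of
  \<open>{..<k}\<close>.\<close>

lemma bprod_support: "bprod js K \<noteq> 0 \<Longrightarrow> K \<subseteq> set js"
proof (induction js arbitrary: K)
  case Nil
  then show ?case by (simp add: clone_def split: if_splits)
next
  case (Cons j js)
  then have "(blade {j} \<odot> bprod js) K \<noteq> 0" by simp
  then obtain I J where "K = sym_diff I J" "blade {j} I \<noteq> 0" "bprod js J \<noteq> 0"
    by (rule clmul_nonzero_obtain)
  then show ?case using Cons.IH[of J] by (auto simp: blade_def split: if_splits)
qed

text \<open>The coefficient with which \<open>bprod js\<close> enters the multilinear expansion of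
  the product of the vectors \<open>us\<close>.\<close>

definition weight :: "(nat \<Rightarrow> real) list \<Rightarrow> nat list \<Rightarrow> real" where
  "weight us js = prod_list (map2 (\<lambda>u j. u j) us js)"

lemma weight_Cons: "weight (u # us) (j # js) = u j * weight us js"
  by (simp add: weight_def)

lemma blade_clmul_sum:
  assumes "finite S"
  shows "(blade I \<odot> (\<lambda>K. \<Sum>a\<in>S. c a * f a K)) K = (\<Sum>a\<in>S. c a * (blade I \<odot> f a) K)"
proof (cases "K \<subseteq> Nset")
  case True
  then show ?thesis
    by (simp add: clmul_eq sum_distrib_left mult.left_commute) (rule sum.swap)
qed (simp add: clmul_eq)

lemma clprod_clvec_expand:
  "clprod p q (map vec us) K
    = (\<Sum>js | set js \<subseteq> Nset \<and> length js = length us. weight us js * bprod js K)"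
proof (induction us arbitrary: K)
  case Nil
  have "{js. set js \<subseteq> Nset \<and> length js = length ([]::nat list)} = {[]}" by auto
  then show ?case by (simp add: weight_def)
next
  case (Cons u us)
  let ?L = "\<lambda>n. {js. set js \<subseteq> Nset \<and> length js = n}"
  have IH: "clprod p q (map vec us) = (\<lambda>K. \<Sum>js\<in>?L (length us). weight us js * bprod js K)"
    using Cons by blast
  have "clprod p q (map vec (u # us)) K = (\<Sum>i<p+q. u i * (\<Sum>js\<in>?L (length us). weight us js * (blade {i} \<odot> bprod js) K))"
    by (simp add: clvec_clmul_expand IH blade_clmul_sum finite_lists_length_eq)
  also have "\<dots> = (\<Sum>i<p+q. \<Sum>js\<in>?L (length us). weight (u # us) (i # js) * bprod (i # js) K)"
    by (simp add: sum_distrib_left weight_Cons mult.assoc)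
  also have "\<dots> = (\<Sum>(i, js)\<in>Nset \<times> ?L (length us). weight (u # us) (i # js) * bprod (i # js) K)"
    by (rule sum.cartesian_product)
  also have "\<dots> = (\<Sum>js\<in>?L (Suc (length us)). weight (u # us) js * bprod js K)"
    by (rule sum.reindex_bij_witness[of _ "\<lambda>js. (hd js, tl js)" "\<lambda>(i, js). i # js"])
      (auto simp: length_Suc_conv)
  finally show ?case by simp
qed

text \<open>In the multilinear expansion only lists of length \<open>k\<close> covering
  \<open>{..<k}\<close>, that is permutations, reach the top blade, each with its sign. What remains
  is the Leibniz formula.\<close>

lemma clprod_top_coefficient:
  assumes "k \<le> p + q"
  shows "clprod p q (map (\<lambda>i. vec (M i)) [0..<k]) {..<k} = detn k M"
proof -
  let ?us = "map M [0..<k]"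
  let ?f = "\<lambda>js. weight ?us js * bprod js {..<k}"
  let ?S = "{js. set js \<subseteq> Nset \<and> length js = k}"
  let ?T = "(\<lambda>\<sigma>. map \<sigma> [0..<k]) ` {\<sigma>. \<sigma> permutes {..<k}}"
  have "clprod p q (map (\<lambda>i. vec (M i)) [0..<k]) {..<k} = (\<Sum>js\<in>?S. ?f js)"
    using clprod_clvec_expand[of ?us "{..<k}"] by (simp add: comp_def)
  also have "\<dots> = (\<Sum>js\<in>?T. ?f js)"
  proof (rule sum.mono_neutral_right)
    show "finite ?S" by (simp add: finite_lists_length_eq)
    show "?T \<subseteq> ?S"
    proof clarify
      fix \<sigma> assume "\<sigma> permutes {..<k}"
      then have "\<sigma> ` {..<k} = {..<k}" by (rule permutes_image)
      then show "set (map \<sigma> [0..<k]) \<subseteq> Nset \<and> length (map \<sigma> [0..<k]) = k"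
        using assms by (simp add: atLeast0LessThan)
    qed
    show "\<forall>js\<in>?S - ?T. ?f js = 0"
    proof (rule ballI, rule ccontr)
      fix js assume js: "js \<in> ?S - ?T" and "?f js \<noteq> 0"
      then have sub: "{..<k} \<subseteq> set js" using bprod_support[of js] by fastforce
      have len: "length js = k" using js by simp
      have "card (set js) \<le> k" using card_length[of js] len by simp
      moreover have "k \<le> card (set js)" using card_mono[OF _ sub] by simp
      ultimately have card: "card (set js) = k" by simp
      then have set: "set js = {..<k}" using card_subset_eq[OF _ sub] by simp
      have dist: "distinct js" using card len by (simp add: card_distinct)
      \<comment> \<open>Indices from \<open>k\<close> on are fixed, as \<open>permutes\<close>
        demands.\<close>
      define \<sigma> where "\<sigma> = (\<lambda>i. if i < k then js ! i else i)"
      have "bij_betw ((!) js) {..<length js} (set js)"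
        using bij_betw_nth[OF dist refl refl] by simp
      then have "bij_betw \<sigma> {..<k} {..<k}"
        using bij_betw_cong[of "{..<k}" \<sigma> "(!) js" "{..<k}"] by (simp add: \<sigma>_def set len)
      then have "\<sigma> permutes {..<k}"
        by (rule bij_imp_permutes) (simp add: \<sigma>_def)
      moreover have "js = map \<sigma> [0..<k]"
        using len by (intro nth_equalityI) (auto simp: \<sigma>_def)
      ultimately show False using js by blast
    qed
  qed
  also have "\<dots> = (\<Sum>\<sigma> | \<sigma> permutes {..<k}. ?f (map \<sigma> [0..<k]))"
  proof (rule sum.reindex_cong)
    show "inj_on (\<lambda>\<sigma>. map \<sigma> [0..<k]) {\<sigma>. \<sigma> permutes {..<k}}"
    proof (rule inj_onI, rule ext)
      fix \<sigma> \<tau> i assume *: "\<sigma> \<in> {\<sigma>. \<sigma> permutes {..<k}}" "\<tau> \<in> {\<sigma>. \<sigma> permutes {..<k}}"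
        "map \<sigma> [0..<k] = map \<tau> [0..<k]"
      then show "\<sigma> i = \<tau> i"
        by (cases "i < k") (auto simp: permutes_not_in map_eq_conv)
    qed
  qed auto
  also have "\<dots> = detn k M"
    unfolding detn_def
  proof (rule sum.cong[OF refl])
    fix \<sigma> assume "\<sigma> \<in> {\<sigma>. \<sigma> permutes {..<k}}"
    then have "bprod (map \<sigma> [0..<k]) {..<k} = of_int (sign \<sigma>)"
      using bprod_permutes[of \<sigma> k] assms by (simp add: clscale_def blade_def)
    moreover have "weight ?us (map \<sigma> [0..<k]) = (\<Prod>i<k. M i (\<sigma> i))"
      by (simp add: weight_def prod.list_conv_set_nth atLeast0LessThan)
    ultimately show "?f (map \<sigma> [0..<k]) = of_int (sign \<sigma>) * (\<Prod>i<k. M i (\<sigma> i))" by simp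
  qed
  finally show ?thesis .
qed

end

section \<open>A Euclidean norm on the Clifford algebra of E\<close>

context clifford_split
begin

abbreviation PE where "PE \<equiv> Pow {..<p'}"

definition ClE :: "cl set" where "ClE = {x. \<forall>I. x I \<noteq> 0 \<longrightarrow> I \<subseteq> {..<p'}}"

text \<open>The inner product for which the blades of \<open>E\<close> are orthonormal. Vectors of
  \<open>E\<close> multiply skewly for it, hence unit vectors preserve its norm.\<close>

definition dot :: "cl \<Rightarrow> cl \<Rightarrow> real" where "dot x y = (\<Sum>I\<in>PE. x I * y I)"

lemma ClE_clmul: "x \<in> ClE \<Longrightarrow> y \<in> ClE \<Longrightarrow> x \<odot> y \<in> ClE"
  unfolding ClE_def by (blast elim: clmul_nonzero_obtain)

lemma clvec_ClE: "v \<in> E \<Longrightarrow> vec v \<in> ClE"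
  by (auto simp: ClE_def clvec_def Espace_def split: if_splits) (meson not_le)

text \<open>Toggling \<open>i\<close> leaves the ordering sign alone, since
  \<open>ordsign i i = 1\<close>, but exactly one of the two sets contains \<open>i\<close> and so
  carries the metric factor -1.\<close>

lemma csign_singleton_sym_diff:
  assumes "i < p'" "I \<subseteq> {..<p'}"
  shows "csign p {i} (sym_diff {i} I) = - csign p {i} I"
proof -
  have fin: "finite I" using assms(2) finite_subset by blast
  have "(\<Prod>j\<in>sym_diff {i} I. ordsign i j) = (\<Prod>j\<in>I. ordsign i j)"
    using fin by (subst prod_sym_diff) (simp_all, simp add: ordsign_def)
  moreover have "(\<Prod>j\<in>{i} \<inter> sym_diff {i} I. - eta p j) = - (\<Prod>j\<in>{i} \<inter> I. - eta p j)"
    using assms(1) p'_le by (cases "i \<in> I") (auto simp: eta_def)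
  ultimately show ?thesis using fin by (simp add: csign_eq_prod)
qed

text \<open>Multiplication by \<open>blade {i}\<close> permutes the blades by the involution
  \<open>sym_diff {i}\<close>; reindexing along it produces the sign of
  \<open>csign_singleton_sym_diff\<close>.\<close>

lemma dot_blade:
  assumes "i < p'"
  shows "dot (blade {i} \<odot> x) y = - dot x (blade {i} \<odot> y)"
proof -
  have sub: "{i} \<subseteq> Nset" using assms p'_le by auto
  have N: "I \<subseteq> Nset" if "I \<in> PE" for I using that subset_Nset by auto
  have "dot (blade {i} \<odot> x) y = (\<Sum>I\<in>PE. csign p {i} (sym_diff {i} I) * x (sym_diff {i} I) * y I)"
    using N sub by (auto simp: dot_def blade_clmul intro!: sum.cong)
  also have "\<dots> = (\<Sum>I\<in>PE. csign p {i} I * x I * y (sym_diff {i} I))"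
  proof (rule sum.reindex_bij_witness[of _ "sym_diff {i}" "sym_diff {i}"])
    fix I assume I: "I \<in> PE"
    have e: "sym_diff {i} (sym_diff {i} I) = I" by auto
    then show "sym_diff {i} (sym_diff {i} I) = I" "sym_diff {i} (sym_diff {i} I) = I" by auto
    show "sym_diff {i} I \<in> PE" "sym_diff {i} I \<in> PE" using I assms by auto
    show "csign p {i} (sym_diff {i} I) * x (sym_diff {i} I) * y (sym_diff {i} (sym_diff {i} I))
      = csign p {i} (sym_diff {i} I) * x (sym_diff {i} I) * y I" unfolding e ..
  qed
  also have "\<dots> = (\<Sum>I\<in>PE. - (x I * (csign p {i} (sym_diff {i} I) * y (sym_diff {i} I))))"
    using assms by (intro sum.cong refl) (simp add: csign_singleton_sym_diff)
  also have "\<dots> = - dot x (blade {i} \<odot> y)"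
    using N sub by (auto simp: dot_def blade_clmul sum_negf intro!: sum.cong)
  finally show ?thesis .
qed

lemma dot_clvec:
  assumes "v \<in> E"
  shows "dot (vec v \<odot> x) y = - dot x (vec v \<odot> y)"
proof -
  have e: "(vec v \<odot> x) K = (\<Sum>i<p'. v i * (blade {i} \<odot> x) K)" for x K
    unfolding clvec_clmul_expand using assms p'_le
    by (intro sum.mono_neutral_right) (auto simp: Espace_def)
  have "dot (vec v \<odot> x) y = (\<Sum>i<p'. v i * dot (blade {i} \<odot> x) y)"
    unfolding dot_def e by (simp add: sum_distrib_left sum_distrib_right mult.assoc sum.swap[of _ "PE"])
  also have "\<dots> = - (\<Sum>i<p'. v i * dot x (blade {i} \<odot> y))"
    by (simp add: dot_blade sum_negf)
  also have "(\<Sum>i<p'. v i * dot x (blade {i} \<odot> y)) = dot x (vec v \<odot> y)"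
    unfolding dot_def e by (simp add: sum_distrib_left mult.left_commute sum.swap[of _ "PE"])
  finally show ?thesis .
qed

lemma dot_clvec_sq:
  assumes "v \<in> E" "x \<in> Cl"
  shows "dot (vec v \<odot> x) (vec v \<odot> x) = ip v v * dot x x"
proof -
  have "vec v \<odot> vec v \<odot> x = clscale (- ip v v) x"
    using assms clvec_sq[of v] by (simp flip: clmul_assoc)
  then have "dot (vec v \<odot> x) (vec v \<odot> x) = - dot x (clscale (- ip v v) x)"
    using dot_clvec[OF assms(1), of x "vec v \<odot> x"] by simp
  also have "\<dots> = ip v v * dot x x"
    by (simp add: dot_def clscale_def sum_negf sum_distrib_left mult.left_commute)
  finally show ?thesis .
qed

lemma clprod_E:
  assumes "\<forall>v\<in>set vs. v \<in> E \<and> ip v v = 1"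
  defines "x \<equiv> clprod p q (map vec vs)"
  shows "x \<in> ClE" "dot x x = 1"
proof -
  have "x \<in> ClE \<and> dot x x = 1"
    using assms(1) unfolding x_def
  proof (induction vs)
    case Nil
    have "dot clone clone = (\<Sum>I\<in>PE. if I = {} then 1 else 0)"
      unfolding dot_def clone_def by (rule sum.cong) auto
    also have "\<dots> = 1" by simp
    finally have "dot clone clone = 1" .
    moreover have "clone \<in> ClE" by (simp add: ClE_def clone_def)
    ultimately show ?case by simp
  next
    case (Cons v vs)
    then show ?case by (simp add: ClE_clmul clvec_ClE dot_clvec_sq)
  qed
  then show "x \<in> ClE" "dot x x = 1" by auto
qed

text \<open>The product of an orthonormal basis has Euclidean norm 1 in \<open>Cl(E)\<close>, and its top coefficient,
  the determinant \<open>\<plusminus>1\<close>, already exhausts this norm.\<close>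
lemma clprod_orthonormal:
  assumes onb: "orthonormal_basis_E p q p' et" and det: "detn p' et = \<epsilon>" "\<epsilon> = 1 \<or> \<epsilon> = -1"
  shows "clprod p q (map (\<lambda>i. vec (et i)) [0..<p']) = clscale \<epsilon> omega"
proof
  fix K
  define x where "x = clprod p q (map vec (map et [0..<p']))"
  have unit: "\<forall>v\<in>set (map et [0..<p']). v \<in> E \<and> ip v v = 1"
    using onb by (auto simp: orthonormal_basis_E_def)
  have x: "x \<in> ClE" "dot x x = 1" unfolding x_def using clprod_E[OF unit] by auto
  have x_eq: "x = clprod p q (map (\<lambda>i. vec (et i)) [0..<p'])" by (simp add: x_def comp_def)
  have top: "x {..<p'} = \<epsilon>"
    using clprod_top_coefficient[of p' et] p'_le det unfolding x_eq by simp
  have "(\<Sum>I\<in>PE. x I * x I) = x {..<p'} * x {..<p'} + (\<Sum>I\<in>PE - {{..<p'}}. x I * x I)"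
    by (rule sum.remove) auto
  then have "(\<Sum>I\<in>PE - {{..<p'}}. x I * x I) = 0"
    using x(2) top det by (auto simp: dot_def)
  then have zero: "x I = 0" if "I \<in> PE" "I \<noteq> {..<p'}" for I
    using that by (subst (asm) sum_nonneg_eq_0_iff) auto
  have "x K = clscale \<epsilon> omega K"
    using x(1) top zero[of K] by (auto simp: clscale_def omega_def blade_def ClE_def)
  then show "clprod p q (map (\<lambda>i. vec (et i)) [0..<p']) K = clscale \<epsilon> omega K"
    by (simp add: x_eq)
qed

end

section \<open>Equivariant maps and the bilinear form\<close>

locale spin_form = clifford_split p q p' for p q p' +
  fixes act :: "cl \<Rightarrow> 'w::real_vector \<Rightarrow> 'w"
    and P :: "'w \<Rightarrow> 'w \<Rightarrow> (nat \<Rightarrow> real)"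
  assumes module: "cl0_module p q act"
    and sym_bilinear: "sym_bilinear_V p q P"
    and equivariant: "equivariant p q act P"
begin

definition F :: "(nat \<Rightarrow> real) \<Rightarrow> 'w \<Rightarrow> 'w \<Rightarrow> real" where "F w s t = ip w (P s t)"
definition D :: "(nat \<Rightarrow> real) \<Rightarrow> (nat \<Rightarrow> real) \<Rightarrow> 'w \<Rightarrow> 'w" where "D u v = act (vec u \<odot> vec v)"
definition T :: "(nat \<Rightarrow> real) \<Rightarrow> 'w \<Rightarrow> 'w" where "T v = act (vec v \<odot> omega)"

lemma act_add: "x \<in> cleven p q \<Longrightarrow> act x (s + t) = act x s + act x t"
  and act_scaleR: "x \<in> cleven p q \<Longrightarrow> act x (c *\<^sub>R s) = c *\<^sub>R act x s"
  and act_cladd: "x \<in> cleven p q \<Longrightarrow> y \<in> cleven p q \<Longrightarrow> act (cladd x y) s = act x s + act y s"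
  and act_clscale: "x \<in> cleven p q \<Longrightarrow> act (clscale c x) s = c *\<^sub>R act x s"
  and act_clone [simp]: "act clone s = s"
  and act_clmul: "x \<in> cleven p q \<Longrightarrow> y \<in> cleven p q \<Longrightarrow> act (x \<odot> y) s = act x (act y s)"
  using module by (simp_all add: cl0_module_def)

lemma P_commute: "P s t = P t s"
  and P_add: "P (s1 + s2) t i = P s1 t i + P s2 t i"
  and P_scaleR: "P (c *\<^sub>R s) t i = c * P s t i"
  using sym_bilinear unfolding sym_bilinear_V_def by blast+

lemma F_commute: "F w s t = F w t s"
  by (simp add: F_def P_commute)

lemma F_add_left: "F w (s1 + s2) t = F w s1 t + F w s2 t"
  by (simp add: F_def P_add innerV_def distrib_left sum.distrib)

lemma F_scaleR_left: "F w (c *\<^sub>R s) t = c * F w s t"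
  by (simp add: F_def P_scaleR innerV_def sum_distrib_left mult.left_commute)

lemma F_add_right: "F w s (t1 + t2) = F w s t1 + F w s t2"
  by (metis F_add_left F_commute)

lemma F_scaleR_right: "F w s (c *\<^sub>R t) = c * F w s t"
  by (metis F_scaleR_left F_commute)

lemma F_uminus_left: "F w (- s) t = - F w s t"
  using F_scaleR_left[of w "-1"] by simp

lemma F_uminus_right: "F w s (- t) = - F w s t"
  using F_scaleR_right[of w s "-1"] by simp

lemma F_diff_left: "F w (s1 - s2) t = F w s1 t - F w s2 t"
  using F_add_left[of w s1 "- s2"] by (simp add: F_uminus_left)

lemma F_diff_right: "F w s (t1 - t2) = F w s t1 - F w s t2"
  using F_add_right[of w s t1 "- t2"] by (simp add: F_uminus_right)

lemmas F_linear = F_add_left F_scaleR_left F_add_right F_scaleR_right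
  F_uminus_left F_uminus_right F_diff_left F_diff_right

lemma F_vec: "F (\<lambda>i. u i + c * v i) s t = F u s t + c * F v s t"
  by (simp add: F_def innerV_linear)

lemma D_add: "D u v (s + t) = D u v s + D u v t" and D_scaleR: "D u v (c *\<^sub>R s) = c *\<^sub>R D u v s"
  by (simp_all add: D_def act_add act_scaleR)

lemma D_uminus: "D u v (- s) = - D u v s"
  using D_scaleR[of u v "-1" s] by simp

lemma T_add: "T v (s + t) = T v s + T v t" and T_scaleR: "T v (c *\<^sub>R s) = c *\<^sub>R T v s"
  by (simp_all add: T_def act_add act_scaleR)

lemma T_uminus: "T v (- s) = - T v s"
  using T_scaleR[of v "-1" s] by simp

lemma T_vec: "T (\<lambda>i. u i + c * v i) s = T u s + c *\<^sub>R T v s"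
  by (simp add: T_def clvec_linear clmul_cladd act_cladd act_clscale)

lemma T_0: "T (\<lambda>_. 0) s = 0"
proof -
  have "vec (\<lambda>_. 0) \<odot> omega = clscale 0 clone"
    by (simp add: fun_eq_iff clmul_eq clvec_def clscale_def)
  then show ?thesis by (simp add: T_def act_clscale)
qed

section \<open>Relations between the operators \<open>D\<close> and \<open>T\<close>\<close>

lemma D_anticomm: "D v u s = - D u v s + (- 2 * ip u v) *\<^sub>R s"
proof -
  have "D u v s + D v u s = (- 2 * ip u v) *\<^sub>R s"
    using clvec_anticomm[of u v] act_clscale[of clone "- 2 * ip u v" s]
    by (simp add: D_def flip: act_cladd)
  then show ?thesis by (metis add_minus_cancel add.commute minus_add_cancel)
qed

text \<open>The first \<open>omega\<close> passes the vector of \<open>E\<close> unchanged and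
  cancels against the second. Passing a vector of \<open>E'\<close> costs a sign, whence the minus
  in \<open>T_T_E'\<close>.\<close>

lemma T_T_E: "v \<in> E \<Longrightarrow> T u (T v s) = D u v s"
proof -
  assume v: "v \<in> E"
  have "(vec u \<odot> omega) \<odot> vec v \<odot> omega = vec u \<odot> (omega \<odot> vec v) \<odot> omega"
    by (simp add: clmul_assoc)
  also have "\<dots> = vec u \<odot> vec v"
    using v by (simp add: omega_E clmul_assoc omega_sq)
  finally show ?thesis by (simp add: T_def D_def flip: act_clmul)
qed

lemma T_T_E': "v \<in> E' \<Longrightarrow> T u (T v s) = - D u v s"
proof -
  assume v: "v \<in> E'"
  have "(vec u \<odot> omega) \<odot> vec v \<odot> omega = vec u \<odot> (omega \<odot> vec v) \<odot> omega"
    by (simp add: clmul_assoc)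
  also have "\<dots> = clscale (- 1) (vec u \<odot> vec v)"
    using v by (simp add: omega_E' clmul_assoc omega_sq)
  finally show ?thesis by (simp add: T_def D_def act_clscale flip: act_clmul)
qed

lemma T_sq: "v \<in> E \<Longrightarrow> T v (T v s) = (- ip v v) *\<^sub>R s"
  by (simp add: T_T_E D_def clvec_sq act_clscale)

lemma T_anticomm: "u \<in> E \<Longrightarrow> v \<in> E \<Longrightarrow> T v (T u s) = - T u (T v s) + (- 2 * ip u v) *\<^sub>R s"
  by (simp add: T_T_E D_anticomm[of v u])

text \<open>The sign from the anticommuting orthogonal vectors cancels the sign from moving
  \<open>omega\<close> past \<open>y\<close>.\<close>

lemma T_commute_E': "u \<in> E \<Longrightarrow> y \<in> E' \<Longrightarrow> T y (T u s) = T u (T y s)"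
  by (simp add: T_T_E T_T_E' D_anticomm[of y u] innerV_E_E')

section \<open>Consequences of equivariance for products of vectors\<close>

lemma act_clbiv: "act (clbiv p q x y) s = (- 1/2) *\<^sub>R D x y s + (- ip x y / 2) *\<^sub>R s"
  by (simp only: clbiv_eq act_cladd act_clscale cleven_clscale cleven_clone clodd_clmul_clodd clvec_clodd D_def act_clone)

lemma equivariance:
  assumes "x \<in> V" "y \<in> V"
  shows "F w (D x y s) t + F w s (D x y t)
    = - 2 * ip x y * F w s t - 2 * (F y s t * ip w x - F x s t * ip w y)"
proof -
  let ?a = "clbiv p q x y"
  have "(\<lambda>i. P (act ?a s) t i + P s (act ?a t) i) = wedge_act p q x y (P s t)"
    using equivariant[unfolded equivariant_def, rule_format, of "1::nat" "\<lambda>_. x" "\<lambda>_. y" s t] assms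
    by (simp add: Let_def lessThan_Suc)
  then have "ip w (\<lambda>i. P (act ?a s) t i + 1 * P s (act ?a t) i) = ip w (\<lambda>i. F y s t * x i + (- F x s t) * y i)"
    by (simp add: wedge_act_def F_def)
  moreover have "ip w (\<lambda>i. F y s t * x i + (- F x s t) * y i) = F y s t * ip w x - F x s t * ip w y"
    by (simp only: innerV_linear) (simp add: innerV_def sum_distrib_left sum_negf mult.left_commute)
  ultimately have "F w (act ?a s) t + F w s (act ?a t) = F y s t * ip w x - F x s t * ip w y"
    by (simp only: innerV_linear F_def)
  then show ?thesis
    by (simp add: act_clbiv F_linear)
qed

text \<open>Reverse the inner product of vectors: \<open>x y y x\<close> is the scalar
  \<open>ip x x * ip y y\<close>, and the Clifford relation supplies the remaining term.\<close>

lemma D_D: "D x y (D x y s) = (- (ip x x * ip y y)) *\<^sub>R s + (- 2 * ip x y) *\<^sub>R D x y s"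
proof -
  have "act (vec x \<odot> vec y) (D x y s) = D x y (- D y x s + (- 2 * ip x y) *\<^sub>R s)"
    by (simp add: D_anticomm[of y x] D_def[symmetric] innerV_commute[of y x])
  also have "\<dots> = - D x y (D y x s) + (- 2 * ip x y) *\<^sub>R D x y s"
    by (simp only: D_add D_scaleR D_uminus)
  also have "D x y (D y x s) = (ip x x * ip y y) *\<^sub>R s"
  proof -
    have "(vec x \<odot> vec y) \<odot> vec y \<odot> vec x = vec x \<odot> (vec y \<odot> vec y) \<odot> vec x"
      by (simp add: clmul_assoc)
    also have "\<dots> = clscale (ip x x * ip y y) clone"
      by (simp add: clvec_sq mult.commute)
    finally show ?thesis by (simp add: D_def act_clscale flip: act_clmul)
  qed
  finally show ?thesis by (simp add: D_def)
qed

text \<open>Equivariance is applied once in each argument, to \<open>D x y s\<close> and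
  \<open>t\<close> and to \<open>s\<close> and \<open>D x y t\<close>. Adding the two results leaves
  sums over both placements of \<open>D x y\<close>, which equivariance at \<open>w = x\<close> and
  \<open>w = y\<close> evaluates. Null vectors are included.\<close>

lemma F_D_D:
  assumes "x \<in> V" "y \<in> V"
  shows "F w (D x y s) (D x y t) = ip x x * ip y y * F w s t
    + ip w x * (4 * ip x y * F y s t - 2 * ip y y * F x s t) - 2 * ip x x * ip w y * F y s t"
proof -
  have 1: "F w (D x y s) (D x y t)
      = ip x x * ip y y * F w s t - 2 * (F y (D x y s) t * ip w x - F x (D x y s) t * ip w y)"
    using equivariance[OF assms, of w "D x y s" t] by (simp add: D_D F_linear)
  have 2: "F w (D x y s) (D x y t)
      = ip x x * ip y y * F w s t - 2 * (F y s (D x y t) * ip w x - F x s (D x y t) * ip w y)"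
    using equivariance[OF assms, of w s "D x y t"] by (simp add: D_D F_linear)
  have 3: "F y s (D x y t) = - F y (D x y s) t - 2 * ip x y * F y s t - 2 * (F y s t * ip x y - F x s t * ip y y)"
    using equivariance[OF assms, of y s t] by (simp add: innerV_commute[of y x])
  have 4: "F x s (D x y t) = - F x (D x y s) t - 2 * ip x y * F x s t - 2 * (F y s t * ip x x - F x s t * ip x y)"
    using equivariance[OF assms, of x s t] by simp
  show ?thesis using 1 2 unfolding 3 4 by (simp add: algebra_simps)
qed

text \<open>By \<open>F_D_D\<close> a pair of distinct basis vectors of \<open>E\<close> reflects
  \<open>w\<close> in the corresponding two coordinates. The induction proceeds in pairs because
  only even products act.\<close>

lemma F_clprod_stdb:
  assumes "even (length js)" "distinct js" "set js \<subseteq> {..<p'}"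
  defines "g \<equiv> clprod p q (map vec (map stdb js))"
  shows "F w (act g s) (act g t) = F (\<lambda>i. if i \<in> set js then - w i else w i) s t"
  using assms(1-3) unfolding g_def
proof (induction js arbitrary: w rule: induct_list012)
  case (3 i j js)
  let ?g = "clprod p q (map vec (map stdb js))"
  let ?w = "\<lambda>k. (w k + (- 2 * w i) * stdb i k) + (- 2 * w j) * stdb j k"
  have ij: "i \<noteq> j" "i < p'" "j < p'" "i < p + q" "j < p + q" "i < p" "j < p" using 3 p'_le by auto
  have V: "stdb i \<in> V" "stdb j \<in> V" using ij stdb_E E_V by auto
  have ip: "ip v (stdb i) = v i" "ip v (stdb j) = v j" for v
    using ij by (simp_all add: innerV_stdb eta_def)
  have g: "?g \<in> cleven p q" using 3 by (intro clprod_even) simp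
  have act: "act (clprod p q (map vec (map stdb (i # j # js)))) s = D (stdb i) (stdb j) (act ?g s)" for s
    using g by (simp add: D_def clmul_assoc flip: act_clmul)
  have "F w (D (stdb i) (stdb j) s) (D (stdb i) (stdb j) t) = F ?w s t" for s t
    using ij by (simp only: F_D_D[OF V] F_vec ip) (simp add: stdb_def)
  then have "F w (act (clprod p q (map vec (map stdb (i # j # js)))) s) (act (clprod p q (map vec (map stdb (i # j # js)))) t)
      = F ?w (act ?g s) (act ?g t)"
    unfolding act by blast
  also have "\<dots> = F (\<lambda>k. if k \<in> set js then - ?w k else ?w k) s t"
    using 3 by (intro "3.IH") auto
  also have "(\<lambda>k. if k \<in> set js then - ?w k else ?w k) = (\<lambda>k. if k \<in> set (i # j # js) then - w k else w k)"
    using 3 ij by (auto simp: fun_eq_iff stdb_def)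
  finally show ?case .
qed auto

text \<open>\<open>- T e\<close> is the action of the even product of the basis vectors of
  \<open>E\<close> other than \<open>e\<close>. It flips every coordinate of \<open>w\<close> except
  the zeroth, which is the map from \<open>w\<close> to \<open>- w + 2 <w,e> e\<close>.\<close>

lemma F_T_e:
  assumes "w \<in> E"
  shows "F w (T e s) (T e t) = - F w s t + 2 * ip w e * F e s t"
proof -
  let ?g = "clprod p q (map vec (map stdb [1..<p']))"
  have "?g = clscale (- 1) (vec e \<odot> omega)"
    using clprod_stdb_tail by (simp add: comp_def)
  then have g: "act ?g s = - T e s" for s by (simp add: T_def act_clscale)
  have "F w (T e s) (T e t) = F w (act ?g s) (act ?g t)"
    unfolding g by (simp add: F_linear)
  also have "\<dots> = F (\<lambda>i. if i \<in> set [1..<p'] then - w i else w i) s t"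
    using p'_odd by (intro F_clprod_stdb) auto
  also have "(\<lambda>i. if i \<in> set [1..<p'] then - w i else w i) = (\<lambda>i. (0 + (- 1) * w i) + (2 * ip w e) * e i)"
    unfolding innerV_e using assms p'_ge by (auto simp: fun_eq_iff Espace_def stdb_def)
  also have "F \<dots> s t = - F w s t + 2 * ip w e * F e s t"
    unfolding F_vec by (simp add: F_def innerV_def)
  finally show ?thesis .
qed

lemma F_T_T:
  assumes "v \<in> E" "w \<in> E"
  shows "F w (T v s) (T v t) = - ip v v * F w s t + 2 * ip w v * F v s t"
proof -
  have T: "T v s = - D v e (T e s)" for s
  proof -
    have "D v e (T e s) = T v (T e (T e s))" by (rule T_T_E[OF e_E, symmetric])
    then show ?thesis using e_E by (simp add: T_sq T_uminus)
  qed
  have "F w (T v s) (T v t) = F w (D v e (T e s)) (D v e (T e t))"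
    by (simp add: T F_linear)
  also have "\<dots> = - ip v v * F w s t + 2 * ip w v * F v s t"
    using assms e_E E_V by (simp add: F_D_D F_T_e algebra_simps)
  finally show ?thesis .
qed

section \<open>Adjoints of \<open>T v\<close> for \<open>F w\<close>, and the comparison of
  directions in E\<close>

lemma F_T_T_left:
  assumes "v \<in> E" "w \<in> E"
  shows "ip v v * F w (T v s) t = ip v v * F w s (T v t) - 2 * ip w v * F v s (T v t)"
  using F_T_T[OF assms, of s "T v t"] assms by (simp add: T_sq F_linear)

text \<open>The case \<open>w = v\<close> of \<open>F_T_T_left\<close> after cancelling the norm of
  \<open>v\<close>; by definiteness a null \<open>v\<close> is zero.\<close>

lemma F_T_skew:
  assumes "v \<in> E"
  shows "F v (T v s) t = - F v s (T v t)"
proof (cases "ip v v = 0")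
  case True
  then have "v = (\<lambda>_. 0)" using assms innerV_E_eq_0 by blast
  then show ?thesis by (simp add: F_def innerV_def)
next
  case False
  have "ip v v * F v (T v s) t = ip v v * (- F v s (T v t))"
    using F_T_T_left[OF assms assms] by simp
  then show ?thesis using False by (metis mult_left_cancel)
qed

lemma F_T_sym:
  assumes "v \<in> E" "w \<in> E" "ip w v = 0"
  shows "F w (T v s) t = F w s (T v t)"
proof (cases "ip v v = 0")
  case True
  then have "v = (\<lambda>_. 0)" using assms innerV_E_eq_0 by blast
  then show ?thesis using F_scaleR_left[of w 0] F_scaleR_right[of w _ 0] by (simp add: T_0)
next
  case False
  then show ?thesis using F_T_T_left[OF assms(1,2), of s t] assms(3) by simp
qed

text \<open>This is equivariance under the infinitesimal rotation in the plane of \<open>e\<close> and \<open>w\<close>.\<close>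
lemma F_T_rotate:
  assumes "w \<in> E" "ip w e = 0" "x \<in> E"
  shows "- F x (T w s) t + F x s (T w t) - 2 * ip x e * F e s (T w t)
    = - 2 * (F e (T e s) t * ip x w - F w (T e s) t * ip x e)"
proof -
  have 1: "D w e (T e s) = - T w s"
    using e_E assms by (simp add: T_sq T_uminus flip: T_T_E)
  have 2: "D w e t = - T e (T w t)"
    using e_E assms T_anticomm[of e w t] by (simp add: innerV_commute[of e w] flip: T_T_E)
  show ?thesis
    using equivariance[of w e x "T e s" t] assms e_E E_V F_T_T[OF e_E \<open>x \<in> E\<close>, of s "T w t"]
    by (simp add: 1 2 F_linear)
qed

text \<open>Take \<open>x = w\<close> in the rotation identity; skewness merges the two terms on its
  left.\<close>

lemma F_T_orth_sq:
  assumes "w \<in> E" "ip w e = 0"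
  shows "F w (T w s) t = ip w w * F e (T e s) t"
  using F_T_rotate[of w w s t] F_T_skew[of w s t] assms by simp

text \<open>Take \<open>x = e\<close> in the rotation identity; \<open>F_T_sym\<close> merges the
  terms containing \<open>T w\<close>.\<close>

lemma F_T_orth_mixed:
  assumes "w \<in> E" "ip w e = 0"
  shows "F e (T w s) t + F w (T e s) t = 0"
  using F_T_rotate[of w e s t] F_T_sym[of w e s t] assms e_E by (simp add: innerV_commute)

text \<open>Split \<open>v\<close> into \<open>w + c e\<close> with \<open>w\<close> orthogonal to
  \<open>e\<close>. The mixed terms cancel, and both square terms are multiples of
  \<open>F e (T e s) t\<close> whose factors add up to \<open>ip v v\<close>.\<close>

lemma F_T_diag:
  assumes "v \<in> E"
  shows "F v (T v s) t = ip v v * F e (T e s) t"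
proof -
  define c where "c = ip v e"
  define w where "w = (\<lambda>i. v i + (- c) * e i)"
  have w: "w \<in> E" unfolding w_def using assms e_E by (rule E_linear)
  have we: "ip w e = 0" unfolding w_def innerV_linear by (simp add: c_def)
  have v: "v = (\<lambda>i. w i + c * e i)" by (simp add: w_def)
  have "ip v v = ip w w + c * c"
    unfolding v innerV_linear using we by (simp add: innerV_commute[of e w])
  moreover have "F v (T v s) t = F w (T w s) t + c * (F e (T w s) t + F w (T e s) t) + c * c * F e (T e s) t"
    unfolding v F_vec T_vec by (simp add: F_linear algebra_simps)
  ultimately show ?thesis
    by (simp only: F_T_orth_sq[OF w we] F_T_orth_mixed[OF w we]) (simp add: algebra_simps)
qed

section \<open>The form \<open>b\<close> and the adjoints of the Clifford operators\<close>

definition b :: "'w \<Rightarrow> 'w \<Rightarrow> real" where "b s t = - F e (T e s) t"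

lemma bform_stdb: "bform p q p' act P stdb = b"
  by (simp add: fun_eq_iff bform_def clprod_stdb_tail[unfolded One_nat_def] act_clscale b_def F_uminus_left
      flip: F_def T_def)

text \<open>\<open>T e\<close> is skew for the symmetric form \<open>F e\<close>.\<close>

lemma b_skew: "b t s = - b s t"
  using F_T_skew[OF e_E, of t s] by (simp add: b_def F_commute)

lemma b_linear: "b (s1 + s2) t = b s1 t + b s2 t" "b (c *\<^sub>R s) t = c * b s t"
  "b s (t1 + t2) = b s t1 + b s t2" "b s (c *\<^sub>R t) = c * b s t"
  "b (- s) t = - b s t" "b s (- t) = - b s t"
  by (simp_all add: b_def F_linear T_add T_scaleR T_uminus)

lemma b_T_T:
  assumes "v \<in> E"
  shows "b (T v s) (T v t) = ip v v * b s t"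
proof (cases "ip v v = 0")
  case True
  then have "v = (\<lambda>_. 0)" using assms innerV_E_eq_0 by blast
  then show ?thesis using True b_linear(2)[of 0] by (simp only: T_0) simp
next
  case False
  \<comment> \<open>The extra factor \<open>ip v v\<close> lets \<open>F_T_diag\<close> rewrite
    \<open>b\<close> through \<open>F v\<close>, for which \<open>F_T_T\<close> at
    \<open>w = v\<close> has no reflection term left over.\<close>
  have "ip v v * b (T v s) (T v t) = - F v (T v (T v s)) (T v t)"
    using F_T_diag[OF assms] by (simp add: b_def)
  also have "\<dots> = - ip v v * F v (T v s) t"
    using F_T_T[OF assms assms, of "T v s" t] by simp
  also have "\<dots> = ip v v * (ip v v * b s t)"
    using F_T_diag[OF assms] by (simp add: b_def)
  finally show ?thesis using False by (metis mult_left_cancel)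
qed

lemma b_T_skew:
  assumes "v \<in> E"
  shows "b (T v s) t = - b s (T v t)"
proof (cases "ip v v = 0")
  case True
  then have "v = (\<lambda>_. 0)" using assms innerV_E_eq_0 by blast
  then show ?thesis using b_linear(2)[of 0] b_linear(4)[of _ 0] by (simp add: T_0)
next
  case False
  have "ip v v * b (T v s) t = ip v v * (- b s (T v t))"
    using b_T_T[OF assms, of s "T v t"] assms by (simp add: T_sq b_linear)
  then show ?thesis using False by (metis mult_left_cancel)
qed

lemma b_T_E'_skew:
  assumes y: "y \<in> E'"
  shows "b (T y s) t = - b s (T y t)"
proof -
  define f where "f = stdb 1"
  have f: "f \<in> E" "ip f f = 1" "ip e f = 0"
    using p'_ge p'_le by (auto simp: f_def stdb_E innerV_stdb eta_def) (auto simp: stdb_def)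
  have orth: "ip e y = 0" "ip y e = 0" "ip f y = 0" "ip y f = 0"
    using innerV_E_E'[OF _ y] e_E f innerV_commute[of y] by auto
  have V: "y \<in> V" "e \<in> V" "f \<in> V" using y f e_E E_V E'_V by auto
  \<comment> \<open>A second direction \<open>f\<close> in \<open>E\<close>, orthogonal to \<open>e\<close>, is needed here: \<open>T y\<close> is the
      composite of \<open>D y f\<close> and \<open>T f\<close>, each of which moves across \<open>F e\<close>.\<close>
  have skew: "F e (T y s) t = - F e s (T y t)" for s t
  proof -
    have 1: "T y s = - D y f (T f s)" for s
      using f by (simp add: T_sq T_uminus flip: T_T_E)
    have 2: "D y f t = T f (T y t)" for t
      using orth y by (simp add: T_T_E' D_anticomm[of y f])
    have "F e (T y s) t = F e (T f s) (D y f t)"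
      using equivariance[OF V(1,3), of e "T f s" t] f orth by (simp add: 1 F_linear)
    also have "\<dots> = - F e s (T y t)"
      unfolding 2 using F_T_T[OF f(1) e_E, of s "T y t"] f by simp
    finally show ?thesis .
  qed
  \<comment> \<open>As \<open>T e (T y s)\<close> equals \<open>- D e y s\<close>, skewness of
    \<open>T y\<close> for \<open>b\<close> comes down to symmetry of \<open>D e y\<close> for
    \<open>F e\<close>.\<close>
  have 3: "T y s = T e (D e y s)" for s
  proof -
    have "T e (T e (T y s)) = - T y s" using e_E by (simp add: T_sq)
    then show ?thesis using y by (simp add: T_T_E' T_uminus)
  qed
  have 4: "D e y s = - T y (T e s)" for s
    using T_commute_E'[OF e_E y, of s] T_T_E'[OF y, of e s] by simp
  have e: "F e (T e s) (T e t) = F e s t" for s t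
    using F_T_T[OF e_E e_E, of s t] by simp
  \<comment> \<open>Move \<open>T y\<close> across by \<open>skew\<close>, write it as
    \<open>T e\<close> after \<open>D e y\<close>, and cancel \<open>T e\<close>, which preserves
    \<open>F e\<close>.\<close>
  have sym: "F e (D e y s) t = F e s (D e y t)" for s t
  proof -
    have "F e (D e y s) t = F e (T e s) (T y t)"
      unfolding 4 by (simp add: F_linear skew)
    also have "\<dots> = F e s (D e y t)" unfolding 3 e ..
    finally show ?thesis .
  qed
  have "F e (T e (T y s)) t = - F e (T e s) (T y t)"
    using y sym by (simp add: 3 e) (simp add: T_T_E' F_linear flip: 3)
  then show ?thesis by (simp add: b_def)
qed

text \<open>The truncated product acts as a multiple of \<open>T (et 0)\<close>, and
  \<open>F_T_diag\<close> replaces the unit vector \<open>et 0\<close> by \<open>e\<close>.\<close>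

lemma bform_orthonormal:
  assumes onb: "orthonormal_basis_E p q p' et" and det: "detn p' et = \<epsilon>" "\<epsilon> = 1 \<or> \<epsilon> = -1"
  shows "bform p q p' act P et s t = \<epsilon> * b s t"
proof -
  have et: "et 0 \<in> E" "ip (et 0) (et 0) = 1"
    using onb p'_ge by (auto simp: orthonormal_basis_E_def)
  have "act (clprod p q (map (\<lambda>i. vec (et i)) [1..<p'])) s = (- \<epsilon>) *\<^sub>R T (et 0) s"
    unfolding clprod_tail[of et, OF et(2)] clprod_orthonormal[OF assms]
    by (simp add: T_def act_clscale)
  then show ?thesis
    using F_T_diag[OF et(1)] et(2)
    by (simp add: bform_def b_def F_linear flip: F_def)
qed

text \<open>Two commuting skew operators have a symmetric product, and the scalar part vanishes by
  orthogonality.\<close>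

lemma b_clbiv_E_E':
  assumes "x \<in> E" "y \<in> E'"
  shows "b (act (clbiv p q x y) s) t = b s (act (clbiv p q x y) t)"
proof -
  have D: "D x y s = - T x (T y s)" for s using assms by (simp add: T_T_E')
  have "b (T x (T y s)) t = b s (T x (T y t))"
    using assms by (simp add: b_T_skew b_T_E'_skew T_commute_E')
  then show ?thesis
    using assms by (simp add: act_clbiv D b_linear innerV_E_E')
qed

text \<open>The adjoint of a product of two skew operators is the reversed product, here
  \<open>D y x\<close>. The scalar term in \<open>clbiv_eq\<close> is exactly the correction that
  turns this into skewness.\<close>

lemma b_clbiv_same:
  assumes "x \<in> E \<and> y \<in> E \<or> x \<in> E' \<and> y \<in> E'"
  shows "b (act (clbiv p q x y) s) t = - b s (act (clbiv p q x y) t)"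
proof -
  have "b (D x y s) t = b s (D y x t)"
    using assms
  proof
    assume "x \<in> E \<and> y \<in> E"
    then show ?thesis by (simp add: b_T_skew flip: T_T_E)
  next
    assume "x \<in> E' \<and> y \<in> E'"
    then show ?thesis
      using T_T_E'[of y x s] T_T_E'[of x y t] b_T_E'_skew[of x "T y s" t] b_T_E'_skew[of y s "T x t"]
      by (simp add: b_linear)
  qed
  also have "\<dots> = - b s (D x y t) - 2 * ip x y * b s t"
    by (simp only: D_anticomm[of y x] b_linear)
  finally show ?thesis by (simp only: act_clbiv b_linear) (simp add: field_simps)
qed

lemma b_clbiv_sum:
  fixes m :: nat
  assumes "\<And>k s t. k < m \<Longrightarrow> b (act (clbiv p q (xs k) (ys k)) s) t = c * b s (act (clbiv p q (xs k) (ys k)) t)"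
  defines "a \<equiv> (\<lambda>I. \<Sum>k<m. clbiv p q (xs k) (ys k) I)"
  shows "b (act a s) t = c * b s (act a t)"
proof -
  let ?a = "\<lambda>m I. \<Sum>k<m. clbiv p q (xs k) (ys k) I"
  \<comment> \<open>Evenness of the partial sums is carried along, since the module laws are
    available for even elements only.\<close>
  have "?a m \<in> cleven p q \<and> b (act (?a m) s) t = c * b s (act (?a m) t)"
    using assms(1)
  proof (induction m)
    case 0
    have "(\<lambda>I. 0) = clscale 0 clone" by (simp add: clscale_def)
    then show ?case using b_linear(2)[of 0] b_linear(4)[of _ 0] by (simp add: act_clscale)
  next
    case (Suc m)
    have "?a (Suc m) = cladd (?a m) (clbiv p q (xs m) (ys m))"
      by (simp add: cladd_def)
    then show ?case using Suc by (simp add: act_cladd b_linear distrib_left)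
  qed
  then show ?thesis by (simp add: a_def)
qed

section \<open>Invariance under the spin groups\<close>

lemma b_D_D_E: "u \<in> E \<Longrightarrow> v \<in> E \<Longrightarrow> b (D u v s) (D u v t) = ip u u * ip v v * b s t"
  by (simp add: b_T_T flip: T_T_E)

text \<open>\<open>D x y\<close> commutes with \<open>T e\<close>, and for \<open>w = e\<close>,
  orthogonal to \<open>x\<close> and \<open>y\<close>, the correction terms of \<open>F_D_D\<close>
  vanish.\<close>

lemma b_D_D_E':
  assumes "x \<in> E'" "y \<in> E'"
  shows "b (D x y s) (D x y t) = ip x x * ip y y * b s t"
proof -
  have "T e (D x y s) = D x y (T e s)"
    using T_T_E'[of y x s] T_T_E'[of y x "T e s"] assms e_E
      T_commute_E'[OF e_E assms(2), of s] T_commute_E'[OF e_E assms(1), of "T y s"]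
    by (metis T_uminus minus_minus)
  moreover have "ip e x = 0" "ip e y = 0" using assms e_E innerV_E_E' by auto
  ultimately show ?thesis
    using assms E'_V by (simp add: b_def F_D_D)
qed

lemma b_clprod:
  assumes "even (length vs)" "\<forall>v\<in>set vs. v \<in> S"
    and "\<And>u v s t. u \<in> S \<Longrightarrow> v \<in> S \<Longrightarrow> b (D u v s) (D u v t) = ip u u * ip v v * b s t"
  defines "g \<equiv> clprod p q (map vec vs)"
  shows "b (act g s) (act g t) = (\<Prod>v\<leftarrow>vs. ip v v) * b s t"
  using assms(1,2) unfolding g_def
proof (induction vs rule: induct_list012)
  case (3 u v vs)
  let ?g = "clprod p q (map vec vs)"
  have "?g \<in> cleven p q" using 3 by (intro clprod_even) simp
  then have "act (clprod p q (map vec (u # v # vs))) s = D u v (act ?g s)" for s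
    by (simp add: D_def flip: act_clmul) (simp add: clmul_assoc)
  then show ?case using 3 assms(3) by simp
qed auto

lemma act_expand:
  assumes "g \<in> cleven p q"
  shows "act g s = (\<Sum>I | I \<subseteq> Nset \<and> even (card I). g I *\<^sub>R act (blade I) s)"
proof -
  let ?r = "\<lambda>S I. if I \<in> S then g I else 0"
  have *: "?r S \<in> cleven p q \<and> act (?r S) s = (\<Sum>I\<in>S. g I *\<^sub>R act (blade I) s)"
    if "finite S" "S \<subseteq> {I. I \<subseteq> Nset \<and> even (card I)}" for S
    using that
  proof (induction S)
    case empty
    have "(\<lambda>I. 0) = clscale 0 clone" by (simp add: clscale_def)
    then show ?case by (simp add: act_clscale)
  next
    case (insert J S)
    have "?r (insert J S) = cladd (clscale (g J) (blade J)) (?r S)"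
      using insert by (auto simp: cladd_def clscale_def blade_def)
    then show ?case using insert by (simp add: act_cladd act_clscale blade_cleven)
  qed
  have "?r {I. I \<subseteq> Nset \<and> even (card I)} = g"
    using assms by (auto simp: cleven_def fun_eq_iff)
  moreover have "finite {I. I \<subseteq> Nset \<and> even (card I)}" by simp
  ultimately show ?thesis using *[OF _ subset_refl] by simp
qed

lemma b_sum_left: "b (\<Sum>i\<in>S. f i) t = (\<Sum>i\<in>S. b (f i) t)"
  using b_linear(2)[of 0] by (induction S rule: infinite_finite_induct) (simp_all add: b_linear)

lemma b_sum_right: "b s (\<Sum>i\<in>S. f i) = (\<Sum>i\<in>S. b s (f i))"
  using b_linear(4)[of _ 0] by (induction S rule: infinite_finite_induct) (simp_all add: b_linear)

text \<open>\<open>W\<close> carries no topology, so continuity is obtained from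
  \<open>act_expand\<close>: the function is quadratic in finitely many coordinates of
  \<open>g\<close>.\<close>

lemma continuous_on_b_act:
  "continuous_on (cleven p q) (\<lambda>g. b (act g s) (act g t))"
proof -
  let ?S = "{I. I \<subseteq> Nset \<and> even (card I)}"
  have "continuous_on (cleven p q) (\<lambda>g::cl. \<Sum>J\<in>?S. \<Sum>I\<in>?S. g J * (g I * b (act (blade I) s) (act (blade J) t)))"
    by (intro continuous_intros continuous_on_subset[OF continuous_on_product_coordinates]) auto
  moreover have "b (act g s) (act g t) = (\<Sum>J\<in>?S. \<Sum>I\<in>?S. g J * (g I * b (act (blade I) s) (act (blade J) t)))"
    if "g \<in> cleven p q" for g
    using act_expand[OF that] by (simp add: b_sum_left b_sum_right b_linear sum_distrib_left)
  ultimately show ?thesis by (simp cong: continuous_on_cong)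
qed

text \<open>Definiteness of \<open>E\<close> excludes vectors of norm -1, so all norm factors are 1
  and no connectedness argument is called for.\<close>

lemma b_spin_E:
  assumes "g \<in> spinset p q E"
  shows "b (act g s) (act g t) = b s t"
proof -
  obtain vs where vs: "g = clprod p q (map vec vs)" "even (length vs)"
      "\<forall>v\<in>set vs. v \<in> E \<and> (ip v v = 1 \<or> ip v v = -1)"
    using assms by (auto simp: spinset_def)
  have "ip v v = 1" if "v \<in> set vs" for v
  proof -
    have "ip v v = (\<Sum>i<p'. v i * v i)" using vs(3) that by (intro innerV_E) auto
    then have "0 \<le> ip v v" by (simp add: sum_nonneg)
    then show ?thesis using vs(3) that by auto
  qed
  then have "(\<Prod>v\<leftarrow>vs. ip v v) = 1"
    by (induction vs) auto
  then show ?thesis using b_clprod[OF vs(2), of E s t] vs b_D_D_E by simp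
qed

text \<open>On \<open>Spin(E')\<close> the form is preserved up to sign, and \<open>b (g s) (g t)\<close> is a polynomial in the
  coefficients of \<open>g\<close>, hence constant on the identity component.\<close>
lemma b_spin0_E':
  assumes "g \<in> spin0set p q E'"
  shows "b (act g s) (act g t) = b s t"
proof -
  let ?h = "\<lambda>g. b (act g s) (act g t)"
  obtain C where C: "connected C" "C \<subseteq> spinset p q E'" "clone \<in> C" "g \<in> C"
    using assms by (auto simp: spin0set_def connected_component_def)
  have "?h g \<in> {b s t, - b s t}" if g: "g \<in> spinset p q E'" for g
  proof -
    obtain vs where vs: "g = clprod p q (map vec vs)" "even (length vs)"
        "\<forall>v\<in>set vs. v \<in> E' \<and> (ip v v = 1 \<or> ip v v = -1)"
      using g by (auto simp: spinset_def)
    have "(\<Prod>v\<leftarrow>vs. ip v v) = 1 \<or> (\<Prod>v\<leftarrow>vs. ip v v) = -1"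
      using vs(3) by (induction vs) auto
    then show ?thesis using b_clprod[OF vs(2), of E' s t] vs b_D_D_E' by auto
  qed
  then have "?h ` C \<subseteq> {b s t, - b s t}" using C(2) by blast
  then have "finite (?h ` C)" using finite_subset by blast
  moreover have "connected (?h ` C)"
    using C(1,2) spinset_even continuous_on_b_act
    by (intro connected_continuous_image continuous_on_subset[OF continuous_on_b_act]) auto
  ultimately obtain c where "?h ` C = {c}"
    using C(3) connected_finite_iff_sing by blast
  then have "?h g = ?h clone" using imageI[OF C(3), of ?h] imageI[OF C(4), of ?h] by simp
  then show ?thesis by simp
qed

lemma b_Kgrp:
  assumes "g \<in> Kgrp p q p'"
  shows "g \<in> cleven p q \<and> (\<forall>s t. b (act g s) (act g t) = b s t)"
  using assms
proof induction
  case (K_mul g h)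
  have "g \<in> cleven p q"
    using K_mul(1) spinset_even connected_component_subset unfolding spin0set_def by blast
  moreover have "b (act g s) (act g t) = b s t" for s t
    using K_mul(1) b_spin_E b_spin0_E' by blast
  ultimately show ?case using K_mul by (simp add: act_clmul)
qed simp

end

theorem mainTheorem20:
  fixes p q p' p'' :: nat
    and act :: "cl \<Rightarrow> 'w::real_vector \<Rightarrow> 'w"
    and P :: "'w \<Rightarrow> 'w \<Rightarrow> (nat \<Rightarrow> real)"
  assumes hp: "p = p' + p''"
    and hp': "p' mod 4 = 3"
    and hW: "cl0_module p q act"
    and hP: "sym_bilinear_V p q P"
    and heq: "equivariant p q act P"
  defines "b \<equiv> bform p q p' act P stdb"
  shows
    "(\<forall>et. orthonormal_basis_E p q p' et \<longrightarrow>
        (\<forall>\<epsilon>::real. (\<epsilon> = 1 \<or> \<epsilon> = -1) \<longrightarrow> detn p' (\<lambda>i j. et i j) = \<epsilon> \<longrightarrow>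
           (\<forall>s t. bform p q p' act P et s t = \<epsilon> * b s t)))
   \<and> (\<forall>s t. b t s = - b s t)
   \<and> (\<forall>g\<in>Kgrp p q p'. \<forall>s t. b (act g s) (act g t) = b s t)
   \<and> (\<forall>(m::nat) xs ys. (\<forall>k<m. xs k \<in> Espace p q p' \<and> ys k \<in> Espace' p q p') \<longrightarrow>
        (let a = (\<lambda>I. \<Sum>k<m. clbiv p q (xs k) (ys k) I) in
          \<forall>s t. b (act a s) t = b s (act a t)))
   \<and> (\<forall>(m::nat) xs ys. (\<forall>k<m. (xs k \<in> Espace p q p' \<and> ys k \<in> Espace p q p') \<or>
                              (xs k \<in> Espace' p q p' \<and> ys k \<in> Espace' p q p')) \<longrightarrow>
        (let a = (\<lambda>I. \<Sum>k<m. clbiv p q (xs k) (ys k) I) in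
          \<forall>s t. b (act a s) t = - b s (act a t)))"
proof -
  interpret S: spin_form p q p' act P
    using hp hp' hW hP heq by unfold_locales auto
  have b: "b = S.b" by (simp add: b_def S.bform_stdb)
  show ?thesis
    unfolding b Let_def
  proof (intro conjI allI impI ballI)
    fix m :: nat and xs ys :: "nat \<Rightarrow> nat \<Rightarrow> real" and s t
    assume "\<forall>k<m. xs k \<in> Espace p q p' \<and> ys k \<in> Espace' p q p'"
    then show "S.b (act (\<lambda>I. \<Sum>k<m. clbiv p q (xs k) (ys k) I) s) t
        = S.b s (act (\<lambda>I. \<Sum>k<m. clbiv p q (xs k) (ys k) I) t)"
      using S.b_clbiv_sum[of m xs ys 1 s t] S.b_clbiv_E_E' by simp
  next
    fix m :: nat and xs ys :: "nat \<Rightarrow> nat \<Rightarrow> real" and s t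
    assume "\<forall>k<m. (xs k \<in> Espace p q p' \<and> ys k \<in> Espace p q p') \<or>
                   (xs k \<in> Espace' p q p' \<and> ys k \<in> Espace' p q p')"
    then show "S.b (act (\<lambda>I. \<Sum>k<m. clbiv p q (xs k) (ys k) I) s) t
        = - S.b s (act (\<lambda>I. \<Sum>k<m. clbiv p q (xs k) (ys k) I) t)"
      using S.b_clbiv_sum[of m xs ys "-1" s t] S.b_clbiv_same by simp
  next
    fix et \<epsilon> s t
    assume "orthonormal_basis_E p q p' et" "\<epsilon> = 1 \<or> \<epsilon> = - 1" "detn p' (\<lambda>i j. et i j) = \<epsilon>"
    then show "bform p q p' act P et s t = \<epsilon> * S.b s t"
      by (intro S.bform_orthonormal)
  next
    fix s t show "S.b t s = - S.b s t" by (rule S.b_skew)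
  next
    fix g s t assume "g \<in> Kgrp p q p'"
    then show "S.b (act g s) (act g t) = S.b s t" using S.b_Kgrp by blast
  qed
qed

end
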